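(* Let $K$ be an algebraically closed field of characteristic zero, let $n,d\ge 2$ be integers, and let $S=K[x_1,\ldots,x_n]$. Let $f_1,\ldots,f_n\in S$ be a regular sequence of homogeneous polynomials of degree $d$ such that $f_i\in K[x_i,\ldots,x_n]$ for every $1\le i\le n$. Let $I=(f_1,\ldots,f_n)$, let $J=\mathrm{Gin}(I)$ be the generic initial ideal of $I$ with respect to the reverse lexicographic order, and let $J_d$ be the set of monomials of degree $d$ in $J$. Then $J_d$ is a revlex set. In particular, if $S/I$ is a monomial complete intersection (that is, $I$ is generated by a regular sequence of $n$ monomials of degree $d$), then $J_d$ is a revlex set.
   Context: The reverse lexicographic (revlex) order is the graded reverse lexicographic order with $x_1>x_2>\cdots>x_n$. The generic initial ideal $\mathrm{Gin}(I)$ of a homogeneous ideal $I\subset S$ is the initial ideal, with respect to this order, of $g(I)$ for a generic linear change of coordinates $g\in GL_n(K)$: there is a nonempty Zariski open subset of $GL_n(K)$ on which $\mathrm{in}(g(I))$ is constant, and $\mathrm{Gin}(I)$ is this common value. A set $M$ of monomials of the same degree is a revlex set if, whenever $u\in M$, every monomial of the same degree that is greater than $u$ in the revlex order is also in $M$. *)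

theory Defs
  imports "HOL-Analysis.Analysis" "HOL-Library.Poly_Mapping"
    "HOL-Computational_Algebra.Polynomial"
begin

section \<open>Polynomial rings\<close>

text \<open>Monomials in the variables indexed by \<^typ>\<open>'i\<close> are written additively, as exponent
  vectors; \<open>('i, 'k) poly_ring\<close> is the polynomial ring $K[x_i : i \in I]$, with the
  convolution product of \<^theory>\<open>HOL-Library.Poly_Mapping\<close>. If \<^typ>\<open>'i\<close> is a finite linear order
  with $n$ elements, its elements in increasing order play the role of $1, \ldots, n$.\<close>

type_synonym 'i monomial = "'i \<Rightarrow>\<^sub>0 nat"
type_synonym ('i, 'k) poly_ring = "'i monomial \<Rightarrow>\<^sub>0 'k"

definition mdeg :: "'i monomial \<Rightarrow> nat" where
  "mdeg u = (\<Sum>i\<in>Poly_Mapping.keys u. Poly_Mapping.lookup u i)"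

definition mono_poly :: "'i monomial \<Rightarrow> ('i, 'k::comm_ring_1) poly_ring" where
  "mono_poly u = Poly_Mapping.single u 1"

definition const_poly :: "'k::comm_ring_1 \<Rightarrow> ('i, 'k) poly_ring" where
  "const_poly c = Poly_Mapping.single 0 c"

definition var_poly :: "'i \<Rightarrow> ('i, 'k::comm_ring_1) poly_ring" where
  "var_poly i = mono_poly (Poly_Mapping.single i 1)"

definition homogeneous_of_degree :: "nat \<Rightarrow> ('i, 'k::comm_ring_1) poly_ring \<Rightarrow> bool" where
  "homogeneous_of_degree d p \<longleftrightarrow> (\<forall>u\<in>Poly_Mapping.keys p. mdeg u = d)"

text \<open>The subring $K[x_i : i \in A]$.\<close>

definition polys_in :: "'i set \<Rightarrow> ('i, 'k::comm_ring_1) poly_ring set" where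
  "polys_in A = {p. \<forall>u\<in>Poly_Mapping.keys p. Poly_Mapping.keys u \<subseteq> A}"

text \<open>The ring homomorphism that maps coefficients by \<open>c\<close> (itself meant to be a ring
  homomorphism) and sends the variable of index \<open>i\<close> to \<open>a i\<close>.\<close>

definition poly_hom ::
    "('k::comm_ring_1 \<Rightarrow> 'b::comm_ring_1) \<Rightarrow> ('i \<Rightarrow> 'b) \<Rightarrow> ('i, 'k) poly_ring \<Rightarrow> 'b" where
  "poly_hom c a p =
     (\<Sum>u\<in>Poly_Mapping.keys p.
        c (Poly_Mapping.lookup p u) * (\<Prod>i\<in>Poly_Mapping.keys u. a i ^ Poly_Mapping.lookup u i))"


section \<open>Ideals and regular sequences\<close>

text \<open>Ideals of a commutative ring are its submodules.\<close>

interpretation ring_module: module "(*) :: 'a::comm_ring_1 \<Rightarrow> 'a \<Rightarrow> 'a"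
  by unfold_locales (simp_all add: algebra_simps)

abbreviation ideal_gen :: "'a::comm_ring_1 set \<Rightarrow> 'a set" where
  "ideal_gen \<equiv> module.span (*)"

definition regular_seq :: "('i::{finite,linorder} \<Rightarrow> 'a::comm_ring_1) \<Rightarrow> bool" where
  "regular_seq f \<longleftrightarrow>
     (\<forall>i p. p * f i \<in> ideal_gen (f ` {..<i}) \<longrightarrow> p \<in> ideal_gen (f ` {..<i})) \<and>
     ideal_gen (range f) \<noteq> UNIV"


section \<open>Reverse lexicographic order and initial ideals\<close>

text \<open>The graded reverse lexicographic order in which smaller indices are larger variables.\<close>

definition revlex_less :: "'i::linorder monomial \<Rightarrow> 'i monomial \<Rightarrow> bool" where
  "revlex_less v u \<longleftrightarrow>
     mdeg v < mdeg u \<or>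
     (mdeg v = mdeg u \<and>
      (\<exists>i. Poly_Mapping.lookup u i < Poly_Mapping.lookup v i \<and>
           (\<forall>j>i. Poly_Mapping.lookup u j = Poly_Mapping.lookup v j)))"

definition is_initial_monomial ::
    "'i::linorder monomial \<Rightarrow> ('i, 'k::comm_ring_1) poly_ring \<Rightarrow> bool" where
  "is_initial_monomial u p \<longleftrightarrow>
     u \<in> Poly_Mapping.keys p \<and> (\<forall>v\<in>Poly_Mapping.keys p. v \<noteq> u \<longrightarrow> revlex_less v u)"

definition initial_ideal ::
    "('i::linorder, 'k::comm_ring_1) poly_ring set \<Rightarrow> ('i, 'k) poly_ring set" where
  "initial_ideal I = ideal_gen {mono_poly u | u. \<exists>p\<in>I. is_initial_monomial u p}"

definition monomials_of_degree ::
    "('i, 'k::comm_ring_1) poly_ring set \<Rightarrow> nat \<Rightarrow> 'i monomial set" where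
  "monomials_of_degree J d = {u. mdeg u = d \<and> mono_poly u \<in> J}"

definition revlex_set :: "'i::linorder monomial set \<Rightarrow> bool" where
  "revlex_set M \<longleftrightarrow>
     (\<forall>u\<in>M. \<forall>v\<in>M. mdeg u = mdeg v) \<and>
     (\<forall>u\<in>M. \<forall>v. mdeg v = mdeg u \<and> revlex_less u v \<longrightarrow> v \<in> M)"


section \<open>Generic initial ideals\<close>

text \<open>The linear change of coordinates $x_j \mapsto \sum_i g_{ij} x_i$.\<close>

definition lin_change ::
    "'k::comm_ring_1^'n^'n \<Rightarrow> ('n::finite, 'k) poly_ring \<Rightarrow> ('n, 'k) poly_ring" where
  "lin_change g = poly_hom const_poly (\<lambda>j. \<Sum>i\<in>UNIV. const_poly (g $ i $ j) * var_poly i)"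

text \<open>Zariski open subsets of $GL_n(K)$: complements of common zero loci of polynomials in the
  matrix entries. Allowing also the inverse of the determinant would give the same open sets.\<close>

definition zariski_open_GL :: "('k::field^'n::finite^'n) set \<Rightarrow> bool" where
  "zariski_open_GL U \<longleftrightarrow>
     (\<exists>P :: ('n \<times> 'n, 'k) poly_ring set.
        U = {g. invertible g \<and> (\<exists>p\<in>P. poly_hom (\<lambda>c. c) (\<lambda>(i, j). g $ i $ j) p \<noteq> 0)})"

text \<open>\<open>is_Gin I J\<close> means $J = \mathrm{Gin}(I)$. Such a \<open>J\<close> is unique if $K$ is infinite, because
  then any two nonempty open subsets of $GL_n(K)$ meet.\<close>

definition is_Gin ::
    "('n::{finite,linorder}, 'k::field) poly_ring set \<Rightarrow> ('n, 'k) poly_ring set \<Rightarrow> bool" where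
  "is_Gin I J \<longleftrightarrow>
     (\<exists>U. zariski_open_GL U \<and> U \<noteq> {} \<and> (\<forall>g\<in>U. initial_ideal (lin_change g ` I) = J))"

text \<open>The ideals \<open>I\<close> such that $S/I$ is a monomial complete intersection, generated in degree \<open>d\<close>.\<close>

definition monomial_complete_intersection ::
    "nat \<Rightarrow> ('n::{finite,linorder}, 'k::field) poly_ring set \<Rightarrow> bool" where
  "monomial_complete_intersection d I \<longleftrightarrow>
     (\<exists>m :: 'n \<Rightarrow> 'n monomial.
        (\<forall>i. mdeg (m i) = d) \<and>
        regular_seq (\<lambda>i. mono_poly (m i) :: ('n, 'k) poly_ring) \<and>
        I = ideal_gen (range (\<lambda>i. mono_poly (m i))))"

end

theory Submission
  imports Defs
begin

text \<open>
  The degree \<open>d\<close> part of \<open>Gin I\<close> is decided by one determinant. Let \<open>M\<close> be the set of the \<open>n\<close>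
  revlex-largest monomials of degree \<open>d\<close>. For a change of coordinates \<open>g\<close>, the degree \<open>d\<close> part of
  \<open>g I\<close> is spanned by \<open>g f\<^sub>1, \<dots>, g f\<^sub>n\<close>. If the \<open>n \<times> n\<close> matrix of their coefficients at \<open>M\<close> is
  nonsingular, then every nonzero element of this span has a monomial in \<open>M\<close>, so its initial
  monomial lies in \<open>M\<close>, and each monomial of \<open>M\<close> arises in this way
  (\<open>monomials_of_initial_ideal\<close>). The determinant is a polynomial in the entries of \<open>g\<close>; so if it
  does not vanish identically, it is nonzero somewhere on the open set that computes \<open>Gin I\<close>,
  as one sees on a line in the space of matrices (\<open>zariski_open_meets_nonvanishing\<close>).

  A matrix with nonzero determinant is found column by column
  (\<open>exists_nonsingular_coefficient_matrix\<close>). As \<open>f\<^sub>i\<close> involves only \<open>x\<^sub>i, \<dots>, x\<^sub>n\<close>, the polynomial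
  \<open>g f\<^sub>i\<close> depends only on the linear forms \<open>\<ell>\<^sub>i, \<dots>, \<ell>\<^sub>n\<close> that replace these variables. With
  \<open>\<ell>\<^bsub>i+1\<^esub>, \<dots>, \<ell>\<^sub>n\<close> already chosen, \<open>\<ell>\<^sub>i\<close> only has to make one nonzero linear functional \<open>\<phi>\<close> of the
  coefficients of \<open>g f\<^sub>i\<close> at \<open>M\<close> nonzero. Replacing \<open>\<ell>\<^sub>i\<close> by \<open>s \<ell>\<^sub>i\<close> turns the value of \<open>\<phi>\<close> into a
  polynomial in \<open>s\<close> whose coefficient at \<open>s\<^sup>d\<close> is \<open>c\<^sub>i \<phi>(\<ell>\<^sub>i\<^sup>d)\<close>, where \<open>c\<^sub>i\<close> is the coefficient of
  \<open>x\<^sub>i\<^sup>d\<close> in \<open>f\<^sub>i\<close>. In characteristic zero all multinomial coefficients are nonzero, so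
  \<open>\<phi>(\<ell>\<^sup>d)\<close> is a nonzero polynomial in the coefficients of \<open>\<ell>\<close>, and a suitable \<open>\<ell>\<^sub>i\<close> exists as soon
  as \<open>c\<^sub>i \<noteq> 0\<close>.

  That \<open>c\<^sub>i \<noteq> 0\<close> is what regularity gives (\<open>regular_triangular_pure_power\<close>). If \<open>i\<close> is the largest
  index with \<open>c\<^sub>i = 0\<close>, then all later variables are nilpotent modulo \<open>(f\<^bsub>i+1\<^esub>, \<dots>, f\<^sub>n)\<close>, and \<open>f\<^sub>i\<close>
  lies in the ideal generated by these variables, so a power of \<open>f\<^sub>i\<close> lies in
  \<open>(f\<^bsub>i+1\<^esub>, \<dots>, f\<^sub>n)\<close>. Since \<open>f\<^sub>i\<close> is a nonzerodivisor modulo the other \<open>f\<^sub>j\<close>, this would force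
  \<open>1 \<in> I\<close>.

  A monomial complete intersection generated in degree \<open>d\<close> is \<open>(x\<^sub>1\<^sup>d, \<dots>, x\<^sub>n\<^sup>d)\<close>
  (\<open>monomial_complete_intersection_eq\<close>), to which the same argument applies.
\<close>

text \<open>Used from left to right this rule reassociates products to the left, against \<open>mult.assoc\<close>.\<close>

declare ring_module.scale_scale [simp del]


section \<open>Monomials and the reverse lexicographic order\<close>

text \<open>Induction on \<open>k\<close>: an upper set stays an upper set when a maximal element of its complement
  is added.\<close>

lemma exists_upper_segment:
  assumes "finite T" "k \<le> card T"
    and irr: "\<And>u. \<not> R u u" and tr: "\<And>u v w. R u v \<Longrightarrow> R v w \<Longrightarrow> R u w"
    and tot: "\<And>u v. u \<in> T \<Longrightarrow> v \<in> T \<Longrightarrow> u \<noteq> v \<Longrightarrow> R u v \<or> R v u"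
  shows "\<exists>M\<subseteq>T. card M = k \<and> (\<forall>u\<in>M. \<forall>v\<in>T. R u v \<longrightarrow> v \<in> M)"
  using assms(2)
proof (induction k)
  case 0
  then show ?case by (intro exI[of _ "{}"]) auto
next
  case (Suc k)
  then obtain M where M: "M \<subseteq> T" "card M = k" "\<forall>u\<in>M. \<forall>v\<in>T. R u v \<longrightarrow> v \<in> M"
    by auto
  have fM: "finite M" using M(1) \<open>finite T\<close> finite_subset by blast
  have "T - M \<noteq> {}" using M Suc.prems fM
    by (metis Diff_eq_empty_iff Suc_n_not_le_n subset_antisym)
  moreover have "finite (T - M)" using \<open>finite T\<close> by simp
  ultimately obtain m where m: "m \<in> T - M" "\<forall>x\<in>T - M. x \<noteq> m \<longrightarrow> \<not> R m x"
    using Finite_Set.bex_max_element[of "T - M" R] irr tr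
    by (metis asymp_onI transp_onI)
  show ?case
  proof (intro exI[of _ "insert m M"] conjI)
    show "insert m M \<subseteq> T" "card (insert m M) = Suc k"
      using m M fM by auto
    show "\<forall>u\<in>insert m M. \<forall>v\<in>T. R u v \<longrightarrow> v \<in> insert m M"
      using m M irr by blast
  qed
qed

lemma mdeg_eq_sum: "mdeg (u :: 'n::finite monomial) = (\<Sum>i\<in>UNIV. Poly_Mapping.lookup u i)"
  unfolding mdeg_def by (rule sum.mono_neutral_left) (auto simp: in_keys_iff)

lemma mdeg_add: "mdeg (u + v) = mdeg u + mdeg (v :: 'n::finite monomial)"
  by (simp add: mdeg_eq_sum lookup_add sum.distrib)

lemma mdeg_single [simp]: "mdeg (Poly_Mapping.single i k) = k"
  by (cases "k = 0") (simp_all add: mdeg_def)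

lemma mdeg_zero [simp]: "mdeg 0 = 0"
  by (simp add: mdeg_def)

lemma mdeg_eq_0_iff: "mdeg u = 0 \<longleftrightarrow> u = (0 :: 'n::finite monomial)"
  by (auto simp: mdeg_eq_sum intro: poly_mapping_eqI)

lemma lookup_le_mdeg: "Poly_Mapping.lookup u i \<le> mdeg (u :: 'n::finite monomial)"
  unfolding mdeg_eq_sum by (rule member_le_sum) auto

lemma eq_single_if_lookup_eq_mdeg:
  assumes "Poly_Mapping.lookup u i = mdeg (u :: 'n::finite monomial)"
  shows "u = Poly_Mapping.single i (mdeg u)"
proof (rule poly_mapping_eqI)
  fix k
  have "(\<Sum>j\<in>UNIV - {i}. Poly_Mapping.lookup u j) = 0"
    using assms by (simp add: mdeg_eq_sum sum.remove[of UNIV i])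
  then show "Poly_Mapping.lookup u k = Poly_Mapping.lookup (Poly_Mapping.single i (mdeg u)) k"
    using assms by (auto simp: lookup_single when_def)
qed

lemma monomial_factor_var:
  assumes "i \<in> Poly_Mapping.keys u"
  shows "u = Poly_Mapping.single i 1 + (u - Poly_Mapping.single i (1::nat))"
  using assms by (intro poly_mapping_eqI)
    (auto simp: lookup_add lookup_minus lookup_single when_def in_keys_iff)

lemma mdeg_remove_var:
  assumes "i \<in> Poly_Mapping.keys (u :: 'n::finite monomial)"
  shows "mdeg u = Suc (mdeg (u - Poly_Mapping.single i 1))"
  using arg_cong[OF monomial_factor_var[OF assms], of mdeg] by (simp add: mdeg_add)

lemma finite_monomials_of_mdeg: "finite {u :: 'n::finite monomial. mdeg u = d}"
proof -
  have "finite (PiE (UNIV :: 'n set) (\<lambda>_. {..d}))"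
    by (rule finite_PiE) auto
  moreover have "Poly_Mapping.lookup ` {u :: 'n monomial. mdeg u = d} \<subseteq> PiE UNIV (\<lambda>_. {..d})"
    using lookup_le_mdeg by auto
  ultimately have "finite (Poly_Mapping.lookup ` {u :: 'n monomial. mdeg u = d})"
    by (rule rev_finite_subset)
  then show ?thesis
    by (rule finite_imageD) (simp add: inj_on_def Poly_Mapping.lookup_inject)
qed

lemma revlex_less_irrefl: "\<not> revlex_less u u"
  by (simp add: revlex_less_def)

lemma revlex_less_trans:
  assumes "revlex_less u v" "revlex_less v w"
  shows "revlex_less u w"
proof (cases "mdeg u = mdeg v \<and> mdeg v = mdeg w")
  case True
  then obtain i k where
    i: "Poly_Mapping.lookup v i < Poly_Mapping.lookup u i"
       "\<forall>j>i. Poly_Mapping.lookup v j = Poly_Mapping.lookup u j" and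
    k: "Poly_Mapping.lookup w k < Poly_Mapping.lookup v k"
       "\<forall>j>k. Poly_Mapping.lookup w j = Poly_Mapping.lookup v j"
    using assms unfolding revlex_less_def by (metis less_irrefl)
  have "Poly_Mapping.lookup w (max i k) < Poly_Mapping.lookup u (max i k)"
    using i k by (cases i k rule: linorder_cases) (auto simp: max_def)
  moreover have "\<forall>j>max i k. Poly_Mapping.lookup w j = Poly_Mapping.lookup u j"
    using i(2) k(2) by (metis max_less_iff_conj)
  moreover have "mdeg u = mdeg w" using True by simp
  ultimately show ?thesis unfolding revlex_less_def by blast
next
  case False
  then have "mdeg u < mdeg w"
    using assms unfolding revlex_less_def by (elim disjE) simp_all
  then show ?thesis unfolding revlex_less_def by simp
qed

lemma revlex_less_total:
  fixes u v :: "'n::{finite,linorder} monomial"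
  assumes "mdeg u = mdeg v" "u \<noteq> v"
  shows "revlex_less u v \<or> revlex_less v u"
proof -
  \<comment> \<open>The comparison is decided at the last variable where the exponents differ.\<close>
  let ?S = "{i. Poly_Mapping.lookup u i \<noteq> Poly_Mapping.lookup v i}"
  have "?S \<noteq> {}" using assms(2) by (auto intro: poly_mapping_eqI)
  then have 1: "Max ?S \<in> ?S" by (intro Max_in) auto
  have 2: "j \<notin> ?S" if "j > Max ?S" for j
    using that by (meson Max_ge finite leD)
  then show ?thesis using assms(1) 1 unfolding revlex_less_def
    by (metis (mono_tags, lifting) linorder_neqE_nat mem_Collect_eq)
qed

lemma revlex_top_segment:
  assumes "k \<le> card {u :: 'n::{finite,linorder} monomial. mdeg u = d}"
  obtains M :: "'n::{finite,linorder} monomial set"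
  where "\<And>u. u \<in> M \<Longrightarrow> mdeg u = d" "card M = k" "finite M"
    "\<And>u v. u \<in> M \<Longrightarrow> mdeg v = d \<Longrightarrow> revlex_less u v \<Longrightarrow> v \<in> M"
proof -
  have "\<exists>M\<subseteq>{u :: 'n monomial. mdeg u = d}. card M = k \<and>
      (\<forall>u\<in>M. \<forall>v\<in>{u. mdeg u = d}. revlex_less u v \<longrightarrow> v \<in> M)"
    by (rule exists_upper_segment[OF finite_monomials_of_mdeg assms])
      (auto simp: revlex_less_irrefl intro: revlex_less_trans dest: revlex_less_total)
  then obtain M :: "'n monomial set" where M: "M \<subseteq> {u. mdeg u = d}" "card M = k"
      "\<forall>u\<in>M. \<forall>v\<in>{u. mdeg u = d}. revlex_less u v \<longrightarrow> v \<in> M"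
    by blast
  moreover have "finite M" using M(1) finite_monomials_of_mdeg finite_subset by blast
  ultimately show thesis by (intro that[of M]) auto
qed

text \<open>The powers \<open>x\<^sub>i\<^sup>d\<close> alone are enough; so there is an upper segment of exactly \<open>n\<close> monomials,
  one for each generator \<open>f\<^sub>i\<close>.\<close>

lemma card_variables_le_card_monomials:
  assumes "d > 0"
  shows "CARD('n) \<le> card {u :: 'n::finite monomial. mdeg u = d}"
proof (rule card_inj_on_le)
  show "inj (\<lambda>i::'n. Poly_Mapping.single i d)"
    using assms by (intro injI) (metis lookup_single_eq lookup_single_not_eq less_irrefl)
qed (auto simp: finite_monomials_of_mdeg)


section \<open>Coefficients and linear changes of coordinates\<close>

lemma poly_ring_eq_sum_single:
  "p = (\<Sum>u\<in>Poly_Mapping.keys p. Poly_Mapping.single u (Poly_Mapping.lookup p u))"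
  for p :: "('i, 'k::comm_ring_1) poly_ring"
  by (rule poly_mapping_eqI)
    (auto simp: lookup_sum lookup_single when_def in_keys_iff)

lemma lookup_single_mult:
  fixes q :: "('i, 'k::comm_ring_1) poly_ring"
  shows "Poly_Mapping.lookup (Poly_Mapping.single a c * q) u =
    (\<Sum>v\<in>Poly_Mapping.keys q. (c * Poly_Mapping.lookup q v when a + v = u))"
  by (subst poly_ring_eq_sum_single[of q])
    (simp add: sum_distrib_left mult_single lookup_sum lookup_single)

lemma lookup_single_mult_add:
  fixes q :: "('i, 'k::comm_ring_1) poly_ring"
  shows "Poly_Mapping.lookup (Poly_Mapping.single a c * q) (a + w) = c * Poly_Mapping.lookup q w"
proof -
  have "(\<Sum>v\<in>Poly_Mapping.keys q. (c * Poly_Mapping.lookup q v when a + v = a + w)) =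
        (\<Sum>v\<in>Poly_Mapping.keys q. (if v = w then c * Poly_Mapping.lookup q v else 0))"
    by (rule sum.cong) (auto simp: when_def)
  then show ?thesis by (auto simp: lookup_single_mult in_keys_iff)
qed

lemma lookup_const_mult:
  fixes q :: "('i, 'k::comm_ring_1) poly_ring"
  shows "Poly_Mapping.lookup (const_poly c * q) u = c * Poly_Mapping.lookup q u"
  using lookup_single_mult_add[of 0 c q u] by (simp add: const_poly_def)

lemma lookup_var_mult:
  fixes q :: "('i, 'k::comm_ring_1) poly_ring"
  shows "Poly_Mapping.lookup (var_poly i * q) u =
    (if i \<in> Poly_Mapping.keys u then Poly_Mapping.lookup q (u - Poly_Mapping.single i 1) else 0)"
proof (cases "i \<in> Poly_Mapping.keys u")
  case True
  then show ?thesis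
    using lookup_single_mult_add[of "Poly_Mapping.single i 1" 1 q "u - Poly_Mapping.single i 1"]
      monomial_factor_var[OF True] by (simp add: var_poly_def mono_poly_def)
next
  case False
  then have "Poly_Mapping.single i 1 + v \<noteq> u" for v
    by (auto simp: in_keys_iff lookup_add)
  with False show ?thesis
    by (simp add: var_poly_def mono_poly_def lookup_single_mult)
qed

lemma const_poly_add: "const_poly (a + b) = const_poly a + const_poly b"
  by (simp add: const_poly_def single_add)

lemma const_poly_mult: "const_poly (a * b) = const_poly a * const_poly b"
  by (simp add: const_poly_def mult_single)

lemma const_poly_0 [simp]: "const_poly 0 = 0"
  by (simp add: const_poly_def)

lemma const_poly_1 [simp]: "const_poly 1 = 1"
  by (simp add: const_poly_def)

lemma const_poly_power: "const_poly (a ^ m) = const_poly a ^ m"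
  by (induction m) (simp_all add: const_poly_mult)

lemma mono_poly_add: "mono_poly (u + v) = mono_poly u * mono_poly v"
  by (simp add: mono_poly_def mult_single)

lemma single_eq_const_mult_mono: "Poly_Mapping.single u c = const_poly c * mono_poly u"
  by (simp add: const_poly_def mono_poly_def mult_single)

lemma homogeneous_mult:
  fixes p q :: "('n::finite, 'k::comm_ring_1) poly_ring"
  assumes "homogeneous_of_degree a p" "homogeneous_of_degree b q"
  shows "homogeneous_of_degree (a + b) (p * q)"
  using assms keys_mult[of p q] unfolding homogeneous_of_degree_def
  by (fastforce simp: mdeg_add)

lemma homogeneous_one: "homogeneous_of_degree 0 (1 :: ('i, 'k::comm_ring_1) poly_ring)"
  by (simp add: homogeneous_of_degree_def)

lemma homogeneous_power:
  fixes p :: "('n::finite, 'k::comm_ring_1) poly_ring"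
  assumes "homogeneous_of_degree a p"
  shows "homogeneous_of_degree (m * a) (p ^ m)"
  by (induction m) (simp_all add: homogeneous_one homogeneous_mult[OF assms])

lemma homogeneous_prod:
  fixes p :: "'j \<Rightarrow> ('n::finite, 'k::comm_ring_1) poly_ring"
  assumes "\<And>j. j \<in> A \<Longrightarrow> homogeneous_of_degree (a j) (p j)"
  shows "homogeneous_of_degree (\<Sum>j\<in>A. a j) (\<Prod>j\<in>A. p j)"
  using assms
  by (induction A rule: infinite_finite_induct) (simp_all add: homogeneous_one homogeneous_mult)

lemma homogeneous_sum:
  assumes "\<And>j. j \<in> A \<Longrightarrow> homogeneous_of_degree a (p j)"
  shows "homogeneous_of_degree a (\<Sum>j\<in>A. p j)"
  using assms keys_sum[of p A] unfolding homogeneous_of_degree_def by blast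

lemma homogeneous_const_mult:
  assumes "homogeneous_of_degree a p"
  shows "homogeneous_of_degree a (const_poly c * p)"
  using assms unfolding homogeneous_of_degree_def
  by (auto simp: in_keys_iff lookup_const_mult)

text \<open>The image of one variable under a change of coordinates, with coefficient vector \<open>a\<close> (a column
  of the matrix).\<close>

definition lin_form :: "('n::finite \<Rightarrow> 'k::comm_ring_1) \<Rightarrow> ('n, 'k) poly_ring" where
  "lin_form a = (\<Sum>i\<in>UNIV. const_poly (a i) * var_poly i)"

lemma homogeneous_lin_form: "homogeneous_of_degree 1 (lin_form a)"
  unfolding lin_form_def
  by (intro homogeneous_sum homogeneous_const_mult)
    (simp add: homogeneous_of_degree_def var_poly_def mono_poly_def)

lemma lin_form_scale: "lin_form (\<lambda>i. s * a i) = const_poly s * lin_form a"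
  by (simp add: lin_form_def const_poly_mult sum_distrib_left mult.assoc)

lemma lin_form_add: "lin_form (\<lambda>i. a i + b i) = lin_form a + lin_form b"
  unfolding lin_form_def const_poly_add distrib_right sum.distrib ..

definition monomial_image ::
    "'k::comm_ring_1^'n^'n \<Rightarrow> 'n::finite monomial \<Rightarrow> ('n, 'k) poly_ring" where
  "monomial_image g u = (\<Prod>j\<in>UNIV. lin_form (\<lambda>i. g $ i $ j) ^ Poly_Mapping.lookup u j)"

text \<open>Summing over any finite superset of the monomials of \<open>p\<close> makes the linearity of \<open>lin_change\<close>
  evident, as two polynomials can then share an index set.\<close>

lemma lin_change_eq_sum:
  assumes "finite A" "Poly_Mapping.keys p \<subseteq> A"
  shows "lin_change g p = (\<Sum>u\<in>A. const_poly (Poly_Mapping.lookup p u) * monomial_image g u)"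
proof -
  have "(\<Prod>i\<in>Poly_Mapping.keys u. lin_form (\<lambda>k. g $ k $ i) ^ Poly_Mapping.lookup u i) =
      monomial_image g u" for u
    unfolding monomial_image_def
    by (rule prod.mono_neutral_left) (auto simp: in_keys_iff)
  then have "lin_change g p = 
    (\<Sum>u\<in>Poly_Mapping.keys p. const_poly (Poly_Mapping.lookup p u) * monomial_image g u)"
    by (simp add: lin_change_def poly_hom_def lin_form_def)
  also have "\<dots> = (\<Sum>u\<in>A. const_poly (Poly_Mapping.lookup p u) * monomial_image g u)"
    using assms by (intro sum.mono_neutral_left) (auto simp: in_keys_iff)
  finally show ?thesis .
qed

lemma homogeneous_monomial_image: "homogeneous_of_degree (mdeg u) (monomial_image g u)"
proof -
  have "homogeneous_of_degree (Poly_Mapping.lookup u j * 1)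
      (lin_form (\<lambda>i. g $ i $ j) ^ Poly_Mapping.lookup u j)" for j
    by (intro homogeneous_power homogeneous_lin_form)
  then show ?thesis
    unfolding monomial_image_def mdeg_eq_sum by (intro homogeneous_prod) simp
qed

lemma lin_change_add: "lin_change g (p + q) = lin_change g p + lin_change g q"
proof -
  let ?A = "Poly_Mapping.keys p \<union> Poly_Mapping.keys q"
  have A: "finite ?A" "Poly_Mapping.keys p \<subseteq> ?A" "Poly_Mapping.keys q \<subseteq> ?A"
    "Poly_Mapping.keys (p + q) \<subseteq> ?A"
    using keys_add[of p q] by auto
  then show ?thesis
    by (simp add: lin_change_eq_sum[of ?A] lookup_add const_poly_add sum.distrib
        distrib_right del: Un_subset_iff)
qed

lemma lin_change_const_mult: "lin_change g (const_poly c * p) = const_poly c * lin_change g p"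
proof -
  have "Poly_Mapping.keys (const_poly c * p) \<subseteq> Poly_Mapping.keys p"
    by (auto simp: in_keys_iff lookup_const_mult)
  then show ?thesis
    by (simp add: lin_change_eq_sum[of "Poly_Mapping.keys p"] lookup_const_mult const_poly_mult
        sum_distrib_left mult.assoc)
qed

lemma lin_change_0 [simp]: "lin_change g 0 = 0"
  by (simp add: lin_change_def poly_hom_def)

lemma lin_change_sum: "lin_change g (\<Sum>x\<in>A. p x) = (\<Sum>x\<in>A. lin_change g (p x))"
  by (induction A rule: infinite_finite_induct) (simp_all add: lin_change_add)

lemma homogeneous_lin_change:
  assumes "homogeneous_of_degree d p"
  shows "homogeneous_of_degree d (lin_change g p)"
  unfolding lin_change_eq_sum[OF finite_keys subset_refl]
proof (intro homogeneous_sum homogeneous_const_mult)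
  fix u assume "u \<in> Poly_Mapping.keys p"
  then have "mdeg u = d" using assms unfolding homogeneous_of_degree_def by blast
  then show "homogeneous_of_degree d (monomial_image g u)"
    using homogeneous_monomial_image[of u g] by simp
qed


section \<open>Ideals generated by homogeneous polynomials or by monomials\<close>

text \<open>This traps all elements of an ideal from what is known of its generators: with \<open>V\<close> the multiples
  of given monomials it describes monomial ideals, with \<open>V\<close> the monomials of degree at least \<open>d\<close> it bounds
  degrees from below.\<close>

lemma subspace_keys_in_upset:
  fixes V :: "'i monomial set"
  assumes V: "\<And>v w. v \<in> V \<Longrightarrow> w + v \<in> V"
  shows "ring_module.subspace {p :: ('i, 'k::comm_ring_1) poly_ring. Poly_Mapping.keys p \<subseteq> V}"
proof (rule ring_module.subspaceI)
  fix p q c :: "('i, 'k) poly_ring"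
  assume "p \<in> {p. Poly_Mapping.keys p \<subseteq> V}"
  then have p: "Poly_Mapping.keys p \<subseteq> V" by simp
  then show "c * p \<in> {p. Poly_Mapping.keys p \<subseteq> V}"
    using keys_mult[of c p] V by blast
  assume "q \<in> {p. Poly_Mapping.keys p \<subseteq> V}"
  then show "p + q \<in> {p. Poly_Mapping.keys p \<subseteq> V}"
    using p keys_add[of p q] by blast
qed simp

lemma mono_poly_in_monomial_ideal:
  assumes "mono_poly u \<in> ideal_gen (mono_poly ` V :: ('i, 'k::comm_ring_1) poly_ring set)"
  obtains v w where "v \<in> V" "u = w + v"
proof -
  let ?W = "{w + v | v w. v \<in> V}"
  have "ring_module.subspace {p :: ('i, 'k) poly_ring. Poly_Mapping.keys p \<subseteq> ?W}"
  proof (rule subspace_keys_in_upset)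
    show "w + v \<in> ?W" if v: "v \<in> ?W" for v w
      using v by (auto simp: add.assoc[symmetric]) blast
  qed
  moreover have "mono_poly ` V \<subseteq> {p :: ('i, 'k) poly_ring. Poly_Mapping.keys p \<subseteq> ?W}"
    by (auto simp: mono_poly_def) (metis add_0)
  ultimately have "Poly_Mapping.keys (mono_poly u :: ('i, 'k) poly_ring) \<subseteq> ?W"
    using assms ring_module.span_minimal by blast
  then show thesis using that by (auto simp: mono_poly_def)
qed

text \<open>Every nonconstant term of \<open>p\<close> raises the degree above \<open>d\<close>. Hence the degree \<open>d\<close> part of an ideal
  generated in degree \<open>d\<close> is the vector space spanned by the generators.\<close>

lemma lookup_mult_homogeneous:
  fixes p q :: "('n::finite, 'k::comm_ring_1) poly_ring"
  assumes "homogeneous_of_degree d q" "mdeg u = d"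
  shows "Poly_Mapping.lookup (p * q) u = Poly_Mapping.lookup p 0 * Poly_Mapping.lookup q u"
proof -
  have "Poly_Mapping.lookup (p * q) u =
      (\<Sum>v\<in>Poly_Mapping.keys p. Poly_Mapping.lookup (Poly_Mapping.single v (Poly_Mapping.lookup p v) * q) u)"
    by (subst poly_ring_eq_sum_single[of p]) (simp only: sum_distrib_right lookup_sum)
  also have "\<dots> = (\<Sum>v\<in>Poly_Mapping.keys p. if v = 0 then Poly_Mapping.lookup p 0 * Poly_Mapping.lookup q u else 0)"
  proof (intro sum.cong refl)
    fix v
    show "Poly_Mapping.lookup (Poly_Mapping.single v (Poly_Mapping.lookup p v) * q) u =
        (if v = 0 then Poly_Mapping.lookup p 0 * Poly_Mapping.lookup q u else 0)"
    proof (cases "v = 0")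
      case True
      then show ?thesis using lookup_const_mult[of _ q u] by (simp add: const_poly_def)
    next
      case False
      have "v + w \<noteq> u" if "w \<in> Poly_Mapping.keys q" for w
      proof
        assume "v + w = u"
        then have "mdeg v + mdeg w = d" using assms(2) by (metis mdeg_add)
        moreover have "mdeg w = d" using assms(1) that by (simp add: homogeneous_of_degree_def)
        ultimately show False using False by (simp add: mdeg_eq_0_iff)
      qed
      then show ?thesis using False by (simp add: lookup_single_mult)
    qed
  qed
  also have "\<dots> = Poly_Mapping.lookup p 0 * Poly_Mapping.lookup q u"
    by (simp add: in_keys_iff)
  finally show ?thesis .
qed

lemma mdeg_ge_in_ideal:
  fixes f :: "'j \<Rightarrow> ('n::finite, 'k::comm_ring_1) poly_ring"
  assumes hom: "\<And>i. homogeneous_of_degree d (f i)"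
    and "p \<in> ideal_gen (range f)" "u \<in> Poly_Mapping.keys p"
  shows "d \<le> mdeg u"
proof -
  have "ring_module.subspace {p :: ('n, 'k) poly_ring. Poly_Mapping.keys p \<subseteq> {u. d \<le> mdeg u}}"
    by (rule subspace_keys_in_upset) (simp add: mdeg_add)
  moreover have "range f \<subseteq> {p. Poly_Mapping.keys p \<subseteq> {u. d \<le> mdeg u}}"
    using hom by (auto simp: homogeneous_of_degree_def)
  ultimately show ?thesis
    using assms(2,3) ring_module.span_minimal by blast
qed


section \<open>Regular sequences of triangular form\<close>

text \<open>Induction on \<open>B\<close>, removing its largest element \<open>m\<close>. From \<open>p f\<^sub>i \<equiv> q f\<^sub>m\<close> modulo the remaining
  generators, \<open>q f\<^sub>m\<close> lies in the ideal of all \<open>f\<^sub>j\<close> with \<open>j < m\<close>, so by regularity \<open>q\<close> does; that is,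
  \<open>q \<equiv> r f\<^sub>i\<close>. Then \<open>(p - r f\<^sub>m) f\<^sub>i \<equiv> 0\<close>, and the induction hypothesis applies to \<open>p - r f\<^sub>m\<close>.\<close>

lemma regular_seq_skip_one:
  fixes f :: "'i::{finite,linorder} \<Rightarrow> 'a::comm_ring_1"
  assumes reg: "regular_seq f"
    and B: "B \<subseteq> {i<..}" "\<And>k j. k \<in> B \<Longrightarrow> i < j \<Longrightarrow> j \<le> k \<Longrightarrow> j \<in> B"
    and p: "p * f i \<in> ideal_gen (f ` ({..<i} \<union> B))"
  shows "p \<in> ideal_gen (f ` ({..<i} \<union> B))"
  using finite[of B] B p
proof (induction B arbitrary: p rule: finite_psubset_induct)
  case (psubset B)
  show ?case
  proof (cases "B = {}")
    case True
    then show ?thesis using reg psubset.prems(3) by (simp add: regular_seq_def)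
  next
    case False
    define m where "m = Max B"
    have m: "m \<in> B" "\<And>k. k \<in> B \<Longrightarrow> k \<le> m"
      using False psubset.hyps by (auto simp: m_def)
    then have "i < m" using psubset.prems(1) by auto
    let ?C = "f ` ({..<i} \<union> (B - {m}))"
    have ins: "f ` ({..<i} \<union> B) = insert (f m) ?C" using m(1) by blast
    have Bm: "B - {m} = {i<..<m}"
    proof (intro equalityI subsetI)
      fix k assume "k \<in> B - {m}"
      then show "k \<in> {i<..<m}" using psubset.prems(1) m(2)[of k] by auto
    next
      fix k assume "k \<in> {i<..<m}"
      then show "k \<in> B - {m}" using psubset.prems(2)[OF m(1), of k] by auto
    qed
    have below_m: "f ` {..<m} = insert (f i) ?C"
    proof -
      have "{..<m} = insert i ({..<i} \<union> (B - {m}))"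
        unfolding Bm using \<open>i < m\<close> by auto
      then show ?thesis by simp
    qed
    obtain q where q: "p * f i - q * f m \<in> ideal_gen ?C"
      using psubset.prems(3) unfolding ins ring_module.span_breakdown_eq by blast
    have "p * f i - (p * f i - q * f m) \<in> ideal_gen (f ` {..<m})"
    proof (rule ring_module.span_diff)
      show "p * f i \<in> ideal_gen (f ` {..<m})"
        using \<open>i < m\<close> by (intro ring_module.span_scale ring_module.span_base) simp
      show "p * f i - q * f m \<in> ideal_gen (f ` {..<m})"
        using q ring_module.span_mono[of ?C "f ` {..<m}"] unfolding below_m by blast
    qed
    then have "q * f m \<in> ideal_gen (f ` {..<m})" by simp
    then have "q \<in> ideal_gen (f ` {..<m})" using reg unfolding regular_seq_def by blast
    then obtain r where r: "q - r * f i \<in> ideal_gen ?C"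
      unfolding below_m ring_module.span_breakdown_eq by blast
    have "(p * f i - q * f m) + f m * (q - r * f i) \<in> ideal_gen ?C"
      using q r by (intro ring_module.span_add ring_module.span_scale)
    also have "(p * f i - q * f m) + f m * (q - r * f i) = (p - r * f m) * f i"
      by (simp add: left_diff_distrib right_diff_distrib mult_ac)
    finally have "(p - r * f m) * f i \<in> ideal_gen ?C" .
    then have "p - r * f m \<in> ideal_gen ?C"
    proof (rule psubset.IH[rotated 3])
      show "B - {m} \<subset> B" using m(1) by blast
      show "B - {m} \<subseteq> {i<..}" unfolding Bm by auto
      show "j \<in> B - {m}" if "k \<in> B - {m}" "i < j" "j \<le> k" for k j
        using that unfolding Bm by auto
    qed
    then show ?thesis unfolding ins ring_module.span_breakdown_eq by blast
  qed
qed

text \<open>Otherwise cancelling \<open>f\<^sub>i\<close> repeatedly modulo the other generators would put \<open>1\<close> into the ideal.\<close>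

lemma regular_seq_not_nilpotent_mod_later:
  fixes f :: "'i::{finite,linorder} \<Rightarrow> 'a::comm_ring_1"
  assumes reg: "regular_seq f"
  shows "f i ^ N \<notin> ideal_gen (f ` {i<..})"
proof
  let ?A = "ideal_gen (f ` ({..<i} \<union> {i<..}))"
  assume "f i ^ N \<in> ideal_gen (f ` {i<..})"
  then have "f i ^ N \<in> ?A"
    using ring_module.span_mono[of "f ` {i<..}" "f ` ({..<i} \<union> {i<..})"] by blast
  then have "1 \<in> ?A"
  proof (induction N)
    case (Suc N)
    have "f i ^ N \<in> ?A"
      by (rule regular_seq_skip_one[OF reg]) (use Suc.prems in \<open>auto simp: mult.commute\<close>)
    then show ?case by (rule Suc.IH)
  qed simp
  then have "1 \<in> ideal_gen (range f)"
    using ring_module.span_mono[of "f ` ({..<i} \<union> {i<..})" "range f"] by blast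
  then have "ideal_gen (range f) = UNIV"
    using ring_module.span_scale[of 1 "range f"] by auto
  then show False using reg by (simp add: regular_seq_def)
qed

definition radical :: "'a::comm_ring_1 set \<Rightarrow> 'a set" where
  "radical A = {p. \<exists>N. p ^ N \<in> A}"

lemma subspace_radical:
  fixes A :: "'a::comm_ring_1 set"
  assumes "ring_module.subspace A"
  shows "ring_module.subspace (radical A)"
proof (rule ring_module.subspaceI)
  show "0 \<in> radical A"
    using ring_module.subspace_0[OF assms] unfolding radical_def
    by (intro CollectI exI[of _ 1]) simp
next
  fix p c assume "p \<in> radical A"
  then obtain N where "p ^ N \<in> A" by (auto simp: radical_def)
  then have "(c * p) ^ N \<in> A"
    using ring_module.subspace_scale[OF assms] by (simp add: power_mult_distrib)
  then show "c * p \<in> radical A" by (auto simp: radical_def)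
next
  fix p q assume "p \<in> radical A" "q \<in> radical A"
  then obtain M N where M: "p ^ M \<in> A" and N: "q ^ N \<in> A" by (auto simp: radical_def)
  \<comment> \<open>In each term of the binomial expansion, one of the two exponents is large enough.\<close>
  have "of_nat ((M + N) choose k) * p ^ k * q ^ (M + N - k) \<in> A" for k
  proof (cases "M \<le> k")
    case True
    then have "p ^ k = p ^ (k - M) * p ^ M" by (simp flip: power_add)
    then show ?thesis
      using ring_module.subspace_scale[OF assms M,
          of "of_nat ((M + N) choose k) * q ^ (M + N - k) * p ^ (k - M)"]
      by (simp add: mult_ac)
  next
    case False
    then have "M + N - k = (M - k) + N" by simp
    then have "q ^ (M + N - k) = q ^ (M - k) * q ^ N" by (simp add: power_add)
    then show ?thesis
      using ring_module.subspace_scale[OF assms N,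
          of "of_nat ((M + N) choose k) * p ^ k * q ^ (M - k)"]
      by (simp add: mult_ac)
  qed
  then have "(p + q) ^ (M + N) \<in> A"
    unfolding binomial_ring by (intro ring_module.subspace_sum[OF assms])
  then show "p + q \<in> radical A" by (auto simp: radical_def)
qed

lemma radical_superset: "A \<subseteq> radical A"
proof
  fix p assume "p \<in> A"
  then have "p ^ 1 \<in> A" by simp
  then show "p \<in> radical A" unfolding radical_def by blast
qed

lemma radical_power_mem: "p ^ m \<in> radical A \<Longrightarrow> p \<in> radical A"
  by (auto simp: radical_def power_mult[symmetric])

text \<open>A monomial of degree \<open>d\<close> in \<open>x\<^sub>i, \<dots>, x\<^sub>n\<close> other than \<open>x\<^sub>i\<^sup>d\<close> is divisible by some \<open>x\<^sub>j\<close> with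
  \<open>j > i\<close>.\<close>

lemma triangular_poly_in_ideal:
  fixes p :: "('n::{finite,linorder}, 'k::comm_ring_1) poly_ring"
  assumes A: "ring_module.subspace A"
    and hom: "homogeneous_of_degree d p" and tri: "p \<in> polys_in {i..}"
    and vars: "\<And>j. i < j \<Longrightarrow> var_poly j \<in> A"
  shows "p - const_poly (Poly_Mapping.lookup p (Poly_Mapping.single i d)) * var_poly i ^ d \<in> A"
proof -
  let ?s = "Poly_Mapping.single i d"
  have other: "Poly_Mapping.single u (Poly_Mapping.lookup p u) \<in> A"
    if u: "u \<in> Poly_Mapping.keys p - {?s}" for u
  proof -
    have d: "mdeg u = d" using u hom by (simp add: homogeneous_of_degree_def)
    have "\<exists>j>i. j \<in> Poly_Mapping.keys u"
    proof (rule ccontr)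
      assume "\<not> ?thesis"
      then have "Poly_Mapping.keys u \<subseteq> {i}"
        using u tri unfolding polys_in_def by force
      then have "mdeg u = (\<Sum>k\<in>{i}. Poly_Mapping.lookup u k)"
        unfolding mdeg_def by (intro sum.mono_neutral_left) (auto simp: in_keys_iff)
      then show False
        using eq_single_if_lookup_eq_mdeg[of u i] u d by simp
    qed
    then obtain j where j: "i < j" "j \<in> Poly_Mapping.keys u" by blast
    have "Poly_Mapping.single u (Poly_Mapping.lookup p u) =
        Poly_Mapping.single (u - Poly_Mapping.single j 1) (Poly_Mapping.lookup p u) * var_poly j"
      using monomial_factor_var[OF j(2)]
      by (simp add: var_poly_def mono_poly_def mult_single add.commute)
    then show ?thesis
      using ring_module.subspace_scale[OF A vars[OF j(1)]] by metis
  qed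
  have pow: "(var_poly i :: ('n, 'k) poly_ring) ^ m = mono_poly (Poly_Mapping.single i m)" for m
    by (induction m) (simp_all add: var_poly_def mono_poly_def mult_single flip: single_add)
  have "p = (\<Sum>u\<in>insert ?s (Poly_Mapping.keys p). Poly_Mapping.single u (Poly_Mapping.lookup p u))"
    by (subst poly_ring_eq_sum_single, rule sum.mono_neutral_left) (auto simp: in_keys_iff)
  also have "\<dots> = Poly_Mapping.single ?s (Poly_Mapping.lookup p ?s) +
      (\<Sum>u\<in>Poly_Mapping.keys p - {?s}. Poly_Mapping.single u (Poly_Mapping.lookup p u))"
    by (rule sum.insert_remove) simp
  finally have "p - const_poly (Poly_Mapping.lookup p ?s) * var_poly i ^ d =
      (\<Sum>u\<in>Poly_Mapping.keys p - {?s}. Poly_Mapping.single u (Poly_Mapping.lookup p u))"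
    unfolding pow single_eq_const_mult_mono[symmetric] by (metis add_diff_cancel_left')
  also have "\<dots> \<in> A" using other by (intro ring_module.subspace_sum[OF A])
  finally show ?thesis .
qed

text \<open>Let \<open>c\<^sub>j\<close> be the coefficient of \<open>x\<^sub>j\<^sup>d\<close> in \<open>f\<^sub>j\<close>, and suppose that \<open>m\<close> is the last index with \<open>c\<^sub>m = 0\<close>.
  Geometrically, on the common zero set of \<open>f\<^bsub>m+1\<^esub>, \<dots>, f\<^sub>n\<close> the later
  variables vanish and hence so does \<open>f\<^sub>m\<close>, so \<open>f\<^sub>m\<close> cuts out nothing new. The radical expresses this
  algebraically.\<close>

lemma regular_triangular_pure_power:
  fixes f :: "'n::{finite,linorder} \<Rightarrow> ('n, 'k::field) poly_ring"
  assumes hom: "\<And>i. homogeneous_of_degree d (f i)"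
    and reg: "regular_seq f" and tri: "\<And>i. f i \<in> polys_in {i..}"
  shows "Poly_Mapping.lookup (f i) (Poly_Mapping.single i d) \<noteq> 0"
proof (rule ccontr)
  let ?c = "\<lambda>j. Poly_Mapping.lookup (f j) (Poly_Mapping.single j d)"
  let ?Z = "{j. ?c j = 0}"
  assume "\<not> ?thesis"
  then have "?Z \<noteq> {}" by blast
  define m where "m = Max ?Z"
  have m0: "?c m = 0" using Max_in[of ?Z] \<open>?Z \<noteq> {}\<close> by (auto simp: m_def)
  have m: "?c j \<noteq> 0" if "j > m" for j
  proof
    assume "?c j = 0"
    then have "j \<le> m" unfolding m_def by (intro Max_ge) simp_all
    with that show False by simp
  qed
  define R where "R = radical (ideal_gen (f ` {m<..}))"
  have R: "ring_module.subspace R"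
    unfolding R_def by (rule subspace_radical) (rule ring_module.subspace_span)
  \<comment> \<open>From the last variable downwards: modulo \<open>R\<close> the variables after \<open>x\<^sub>j\<close> vanish, so \<open>f\<^sub>j\<close> becomes
    \<open>c\<^sub>j x\<^sub>j\<^sup>d\<close> with \<open>c\<^sub>j\<close> a unit.\<close>
  have vars: "var_poly j \<in> R" if "m < j" for j
    using finite[of "{j<..}"] that
  proof (induction "{j<..}" arbitrary: j rule: finite_psubset_induct)
    case psubset
    have "var_poly k \<in> R" if "j < k" for k
      using psubset.prems that by (intro psubset.hyps(2)) auto
    then have tail: "f j - const_poly (?c j) * var_poly j ^ d \<in> R"
      by (rule triangular_poly_in_ideal[OF R hom tri])
    have "f j \<in> R"
      using psubset.prems radical_superset ring_module.span_base[of "f j" "f ` {m<..}"]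
      unfolding R_def by blast
    then have "f j - (f j - const_poly (?c j) * var_poly j ^ d) \<in> R"
      using tail by (rule ring_module.subspace_diff[OF R])
    then have "const_poly (?c j) * var_poly j ^ d \<in> R"
      unfolding diff_diff_eq2 add_diff_cancel_left' .
    then have "const_poly (inverse (?c j)) * (const_poly (?c j) * var_poly j ^ d) \<in> R"
      by (rule ring_module.subspace_scale[OF R])
    then have "var_poly j ^ d \<in> R"
      using m[OF psubset.prems] by (simp flip: mult.assoc const_poly_mult)
    then show ?case unfolding R_def by (rule radical_power_mem)
  qed
  have "f m - const_poly (?c m) * var_poly m ^ d \<in> R"
    by (rule triangular_poly_in_ideal[OF R hom tri vars])
  then have "f m \<in> R" using m0 by simp
  then show False
    using regular_seq_not_nilpotent_mod_later[OF reg] by (auto simp: R_def radical_def)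
qed


section \<open>Monomial complete intersections\<close>

lemma mono_poly_factor_var:
  assumes "k \<in> Poly_Mapping.keys u"
  shows "mono_poly u = mono_poly (u - Poly_Mapping.single k 1) * var_poly k"
  unfolding var_poly_def mono_poly_add[symmetric]
  using monomial_factor_var[OF assms] by (simp add: add.commute)

text \<open>If \<open>x\<^sub>k\<close> divides both \<open>m\<^sub>i\<close> and \<open>m\<^sub>j\<close>, then \<open>(m\<^sub>i / x\<^sub>k) m\<^sub>j\<close> is a multiple of \<open>m\<^sub>i\<close>, and regularity
  puts \<open>m\<^sub>i / x\<^sub>k\<close> into an ideal generated in degree \<open>d\<close>, although its degree is \<open>d - 1\<close>.\<close>

lemma monomial_regular_seq_disjoint:
  fixes m :: "'n::{finite,linorder} \<Rightarrow> 'n monomial"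
  assumes deg: "\<And>i. mdeg (m i) = d"
    and reg: "regular_seq (\<lambda>i. mono_poly (m i) :: ('n, 'k::comm_ring_1) poly_ring)"
    and ij: "i < j"
  shows "Poly_Mapping.keys (m i) \<inter> Poly_Mapping.keys (m j) = {}"
proof (rule ccontr)
  assume "\<not> ?thesis"
  then obtain k where k: "k \<in> Poly_Mapping.keys (m i)" "k \<in> Poly_Mapping.keys (m j)" by blast
  let ?I = "ideal_gen ((\<lambda>i. mono_poly (m i) :: ('n, 'k) poly_ring) ` {..<j})"
  let ?p = "mono_poly (m i - Poly_Mapping.single k 1) :: ('n, 'k) poly_ring"
  have "?p * mono_poly (m j) = mono_poly (m j - Poly_Mapping.single k 1) * mono_poly (m i)"
    by (simp add: mono_poly_factor_var[OF k(1)] mono_poly_factor_var[OF k(2)] mult_ac)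
  also have "\<dots> \<in> ?I"
    using ij by (intro ring_module.span_scale ring_module.span_base) auto
  finally have "?p \<in> ?I" using reg unfolding regular_seq_def by blast
  then have "?p \<in> ideal_gen (mono_poly ` (m ` {..<j}))" by (simp add: image_image)
  then obtain v w where "v \<in> m ` {..<j}" "m i - Poly_Mapping.single k 1 = w + v"
    by (rule mono_poly_in_monomial_ideal)
  then have "d \<le> mdeg (m i - Poly_Mapping.single k 1)" using deg by (auto simp: mdeg_add)
  then show False using mdeg_remove_var[OF k(1)] deg[of i] by simp
qed

text \<open>The \<open>n\<close> generators have nonempty and pairwise disjoint supports among \<open>n\<close> variables, so each is a
  power of its own variable.\<close>

lemma monomial_complete_intersection_eq:
  fixes I :: "('n::{finite,linorder}, 'k::field) poly_ring set"
  assumes "monomial_complete_intersection d I" "d > 0"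
  shows "I = ideal_gen (range (\<lambda>i. mono_poly (Poly_Mapping.single i d)))"
proof -
  obtain m :: "'n \<Rightarrow> 'n monomial" where m: "\<And>i. mdeg (m i) = d"
    "regular_seq (\<lambda>i. mono_poly (m i) :: ('n, 'k) poly_ring)"
    "I = ideal_gen (range (\<lambda>i. mono_poly (m i)))"
    using assms(1) unfolding monomial_complete_intersection_def by blast
  have disj: "i = j" if "k \<in> Poly_Mapping.keys (m i)" "k \<in> Poly_Mapping.keys (m j)" for i j k
    using monomial_regular_seq_disjoint[OF m(1,2), of i j]
      monomial_regular_seq_disjoint[OF m(1,2), of j i] that
    by (metis disjoint_iff linorder_neqE)
  have "\<exists>k. k \<in> Poly_Mapping.keys (m i)" for i
  proof (rule ccontr)
    assume "\<not> ?thesis"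
    then have "mdeg (m i) = 0" by (auto simp: mdeg_def)
    then show False using m(1)[of i] \<open>d > 0\<close> by simp
  qed
  then obtain \<sigma> where \<sigma>: "\<And>i. \<sigma> i \<in> Poly_Mapping.keys (m i)" by metis
  have "inj \<sigma>" using disj \<sigma> by (metis injI)
  then have "surj \<sigma>" by (simp add: finite_UNIV_inj_surj)
  have "m i = Poly_Mapping.single (\<sigma> i) d" for i
  proof -
    have "k = \<sigma> i" if "k \<in> Poly_Mapping.keys (m i)" for k
      using \<open>surj \<sigma>\<close> disj \<sigma> that by (metis surjD)
    then have "Poly_Mapping.keys (m i) = {\<sigma> i}" using \<sigma> by blast
    then have "mdeg (m i) = Poly_Mapping.lookup (m i) (\<sigma> i)" by (simp add: mdeg_def)
    then show ?thesis using eq_single_if_lookup_eq_mdeg[of "m i" "\<sigma> i"] m(1)[of i] by metis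
  qed
  then have "range (\<lambda>i. mono_poly (m i) :: ('n, 'k) poly_ring) =
      (\<lambda>i. mono_poly (Poly_Mapping.single i d)) ` range \<sigma>"
    by (simp add: image_image)
  then show ?thesis using m(3) \<open>surj \<sigma>\<close> by simp
qed


section \<open>Powers of linear forms and the choice of one column\<close>

lemma lookup_lin_form_mult:
  "Poly_Mapping.lookup (lin_form a * q) u =
    (\<Sum>i\<in>Poly_Mapping.keys u. a i * Poly_Mapping.lookup q (u - Poly_Mapping.single i 1))"
proof -
  have "Poly_Mapping.lookup (lin_form a * q) u =
      (\<Sum>i\<in>UNIV. if i \<in> Poly_Mapping.keys u
          then a i * Poly_Mapping.lookup q (u - Poly_Mapping.single i 1) else 0)"
    unfolding lin_form_def sum_distrib_right lookup_sum
    by (rule sum.cong) (simp_all add: mult.assoc lookup_const_mult lookup_var_mult)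
  also have "\<dots> = (\<Sum>i\<in>Poly_Mapping.keys u.
      a i * Poly_Mapping.lookup q (u - Poly_Mapping.single i 1))"
    by (rule sum.mono_neutral_cong_right) auto
  finally show ?thesis .
qed

text \<open>The numbers \<open>N u\<close> are the multinomial coefficients. All that matters is that they are positive and do
  not depend on the linear form; both follow from the recursion that peels off one factor.\<close>

lemma coefficients_of_power_of_linear_form:
  obtains N :: "'n::finite monomial \<Rightarrow> nat"
  where "\<And>u. mdeg u = m \<Longrightarrow> N u > 0"
    "\<And>(a :: 'n \<Rightarrow> 'k::comm_ring_1) u. mdeg u = m \<Longrightarrow>
      Poly_Mapping.lookup (lin_form a ^ m) u = of_nat (N u) * (\<Prod>i\<in>UNIV. a i ^ Poly_Mapping.lookup u i)"
proof -
  have "\<exists>N :: 'n monomial \<Rightarrow> nat. (\<forall>u. mdeg u = m \<longrightarrow> N u > 0) \<and>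
     (\<forall>(a :: 'n \<Rightarrow> 'k) u. mdeg u = m \<longrightarrow>
      Poly_Mapping.lookup (lin_form a ^ m) u = of_nat (N u) * (\<Prod>i\<in>UNIV. a i ^ Poly_Mapping.lookup u i))"
  proof (induction m)
    case 0
    show ?case by (intro exI[of _ "\<lambda>_. 1"]) (simp add: mdeg_eq_0_iff)
  next
    case (Suc m)
    then obtain N :: "'n monomial \<Rightarrow> nat" where N: "\<And>u. mdeg u = m \<Longrightarrow> N u > 0"
      "\<And>(a :: 'n \<Rightarrow> 'k) u. mdeg u = m \<Longrightarrow>
      Poly_Mapping.lookup (lin_form a ^ m) u = of_nat (N u) * (\<Prod>i\<in>UNIV. a i ^ Poly_Mapping.lookup u i)"
      by blast
    let ?N = "\<lambda>u. \<Sum>i\<in>Poly_Mapping.keys u. N (u - Poly_Mapping.single i 1)"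
    show ?case
    proof (intro exI[of _ ?N] conjI allI impI)
      fix u :: "'n monomial" assume u: "mdeg u = Suc m"
      have d: "mdeg (u - Poly_Mapping.single i 1) = m" if "i \<in> Poly_Mapping.keys u" for i
        using mdeg_remove_var[OF that] u by simp
      have "Poly_Mapping.keys u \<noteq> {}"
        using u by (metis Zero_not_Suc sum.empty mdeg_def)
      then show "?N u > 0"
        using N(1) d by (intro sum_pos) auto
      fix a :: "'n \<Rightarrow> 'k"
      have fac: "a i * (\<Prod>j\<in>UNIV. a j ^ Poly_Mapping.lookup (u - Poly_Mapping.single i 1) j) =
          (\<Prod>j\<in>UNIV. a j ^ Poly_Mapping.lookup u j)" if i: "i \<in> Poly_Mapping.keys u" for i
      proof -
        have "(\<Prod>j\<in>UNIV. a j ^ Poly_Mapping.lookup u j) =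
          (\<Prod>j\<in>UNIV. a j ^ Poly_Mapping.lookup (Poly_Mapping.single i 1 + (u - Poly_Mapping.single i 1)) j)"
          using monomial_factor_var[OF i] by simp
        also have "\<dots> = (\<Prod>j\<in>UNIV. a j ^ Poly_Mapping.lookup (Poly_Mapping.single i 1) j) *
          (\<Prod>j\<in>UNIV. a j ^ Poly_Mapping.lookup (u - Poly_Mapping.single i 1) j)"
          by (simp only: lookup_add power_add prod.distrib)
        also have "(\<Prod>j\<in>UNIV. a j ^ Poly_Mapping.lookup (Poly_Mapping.single i 1) j) =
            (\<Prod>j\<in>UNIV. if j = i then a j else 1)"
          by (rule prod.cong) (auto simp: lookup_single when_def)
        finally show ?thesis by simp
      qed
      show "Poly_Mapping.lookup (lin_form a ^ Suc m) u =
          of_nat (?N u) * (\<Prod>i\<in>UNIV. a i ^ Poly_Mapping.lookup u i)"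
        unfolding power_Suc lookup_lin_form_mult of_nat_sum sum_distrib_right
        by (rule sum.cong) (simp_all add: N(2)[OF d] fac[symmetric] mult_ac del: One_nat_def)
    qed
  qed
  then show thesis using that by blast
qed

text \<open>Kronecker substitution: read the exponents as digits in a base \<open>B\<close> that exceeds all of them.\<close>

lemma separating_weights:
  fixes M :: "'n::finite monomial set"
  assumes "finite M"
  obtains w :: "'n \<Rightarrow> nat" where "inj_on (\<lambda>u. \<Sum>i\<in>UNIV. w i * Poly_Mapping.lookup u i) M"
proof -
  obtain B where B: "\<And>u i. u \<in> M \<Longrightarrow> Poly_Mapping.lookup u i < B"
  proof -
    have "Poly_Mapping.lookup u i < Suc (\<Sum>v\<in>M. mdeg v)" if "u \<in> M" for u i
      using lookup_le_mdeg[of u i] member_le_sum[OF that _ assms, of mdeg] by auto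
    then show thesis by (rule that)
  qed
  have "\<exists>w. \<forall>u\<in>M. \<forall>v\<in>M. (\<Sum>i\<in>A. w i * Poly_Mapping.lookup u i) = (\<Sum>i\<in>A. w i * Poly_Mapping.lookup v i)
      \<longrightarrow> (\<forall>i\<in>A. Poly_Mapping.lookup u i = Poly_Mapping.lookup v i)" if "finite A" for A :: "'n set"
    using that
  proof (induction A)
    case (insert a A)
    then obtain w where w: "\<And>u v. u \<in> M \<Longrightarrow> v \<in> M \<Longrightarrow>
        (\<Sum>i\<in>A. w i * Poly_Mapping.lookup u i) = (\<Sum>i\<in>A. w i * Poly_Mapping.lookup v i)
      \<Longrightarrow> \<forall>i\<in>A. Poly_Mapping.lookup u i = Poly_Mapping.lookup v i" by blast
    \<comment> \<open>The new variable takes the lowest digit, and all other digits move up by one place.\<close>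
    define w' where "w' = (\<lambda>i. if i = a then 1 else B * w i)"
    have w': "(\<Sum>i\<in>insert a A. w' i * Poly_Mapping.lookup u i) =
        Poly_Mapping.lookup u a + B * (\<Sum>i\<in>A. w i * Poly_Mapping.lookup u i)" for u
    proof -
      have "(\<Sum>i\<in>A. w' i * Poly_Mapping.lookup u i) = (\<Sum>i\<in>A. B * (w i * Poly_Mapping.lookup u i))"
        using insert.hyps(2) by (intro sum.cong) (auto simp: w'_def)
      then show ?thesis
        using insert.hyps by (simp add: w'_def sum_distrib_left)
    qed
    show ?case
    proof (intro exI[of _ w'] ballI impI)
      fix u v i assume uv: "u \<in> M" "v \<in> M" and i: "i \<in> insert a A"
        and "(\<Sum>i\<in>insert a A. w' i * Poly_Mapping.lookup u i) = (\<Sum>i\<in>insert a A. w' i * Poly_Mapping.lookup v i)"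
      then have eq: "Poly_Mapping.lookup u a + B * (\<Sum>i\<in>A. w i * Poly_Mapping.lookup u i) =
         Poly_Mapping.lookup v a + B * (\<Sum>i\<in>A. w i * Poly_Mapping.lookup v i)"
        by (simp only: w')
      have a: "Poly_Mapping.lookup u a = Poly_Mapping.lookup v a"
        using arg_cong[OF eq, of "\<lambda>x. x mod B"] B uv by simp
      have "B \<noteq> 0" using B uv by (metis not_less0)
      then have "(\<Sum>i\<in>A. w i * Poly_Mapping.lookup u i) = (\<Sum>i\<in>A. w i * Poly_Mapping.lookup v i)"
        using eq a by simp
      then show "Poly_Mapping.lookup u i = Poly_Mapping.lookup v i"
        using w[OF uv] a i by blast
    qed
  qed auto
  from this[OF finite[of UNIV]] obtain w where "\<forall>u\<in>M. \<forall>v\<in>M. (\<Sum>i\<in>UNIV. w i * Poly_Mapping.lookup u i) = (\<Sum>i\<in>UNIV. w i * Poly_Mapping.lookup v i)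
      \<longrightarrow> (\<forall>i\<in>UNIV. Poly_Mapping.lookup u i = Poly_Mapping.lookup v i)" by blast
  then have "inj_on (\<lambda>u. \<Sum>i\<in>UNIV. w i * Poly_Mapping.lookup u i) M"
    by (intro inj_onI poly_mapping_eqI) blast
  then show thesis by (rule that)
qed

lemma poly_nonzero_obtains_nonroot:
  fixes q :: "'k::field_char_0 poly"
  assumes "q \<noteq> 0"
  obtains t where "poly q t \<noteq> 0"
  using ex_new_if_finite[OF infinite_UNIV_char_0 poly_roots_finite[OF assms]] by blast

text \<open>The point is found on the curve \<open>t \<mapsto> (t\<^bsup>w\<^sub>i\<^esup>)\<close>, on which separating weights give distinct
  monomials distinct powers of \<open>t\<close>.\<close>

lemma nonzero_polynomial_function:
  fixes c :: "'j \<Rightarrow> 'k::field_char_0" and b :: "'j \<Rightarrow> 'n::finite monomial"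
  assumes "finite A" "inj_on b A" "j0 \<in> A" "c j0 \<noteq> 0"
  obtains a where "(\<Sum>j\<in>A. c j * (\<Prod>i\<in>UNIV. a i ^ Poly_Mapping.lookup (b j) i)) \<noteq> 0"
proof -
  obtain w where w: "inj_on (\<lambda>u. \<Sum>i\<in>UNIV. w i * Poly_Mapping.lookup u i) (b ` A)"
    using separating_weights[of "b ` A"] \<open>finite A\<close> by blast
  define wt where "wt = (\<lambda>j. \<Sum>i\<in>UNIV. w i * Poly_Mapping.lookup (b j) i)"
  have wt: "inj_on wt A"
    using comp_inj_on[OF assms(2) w] by (simp add: wt_def comp_def)
  define q where "q = (\<Sum>j\<in>A. monom (c j) (wt j))"
  have "coeff q (wt j0) = (\<Sum>j\<in>A. if j = j0 then c j else 0)"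
    unfolding q_def coeff_sum using wt \<open>j0 \<in> A\<close>
    by (intro sum.cong) (auto dest: inj_onD)
  then have "coeff q (wt j0) \<noteq> 0" using assms by simp
  then have "q \<noteq> 0" by auto
  then obtain t where t: "poly q t \<noteq> 0" by (rule poly_nonzero_obtains_nonroot)
  have "poly q t = (\<Sum>j\<in>A. c j * (\<Prod>i\<in>UNIV. (t ^ w i) ^ Poly_Mapping.lookup (b j) i))"
    unfolding q_def poly_sum poly_monom wt_def power_sum by (simp add: power_mult)
  with t show thesis using that by metis
qed

definition replace_column :: "'k^'n^'n \<Rightarrow> 'n::finite \<Rightarrow> ('n \<Rightarrow> 'k) \<Rightarrow> 'k^'n^'n" where
  "replace_column g j a = (\<chi> i k. if k = j then a i else g $ i $ k)"

lemma monomial_image_scaled_column: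
  "monomial_image (replace_column g j (\<lambda>i. s * a i)) u =
    const_poly (s ^ Poly_Mapping.lookup u j) * monomial_image (replace_column g j a) u"
proof -
  have "monomial_image (replace_column g j (\<lambda>i. s * a i)) u = 
    (\<Prod>k\<in>UNIV. (if k = j then const_poly s ^ Poly_Mapping.lookup u k else 1) *
       lin_form (\<lambda>i. replace_column g j a $ i $ k) ^ Poly_Mapping.lookup u k)"
    unfolding monomial_image_def
    by (rule prod.cong) (auto simp: replace_column_def lin_form_scale power_mult_distrib)
  then show ?thesis
    by (simp add: prod.distrib monomial_image_def const_poly_power)
qed

lemma monomial_image_power_of_column:
  "monomial_image (replace_column g j a) (Poly_Mapping.single j d) = lin_form a ^ d"
proof -
  have "monomial_image (replace_column g j a) (Poly_Mapping.single j d) =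
    (\<Prod>k\<in>UNIV. if k = j then lin_form a ^ d else 1)"
    unfolding monomial_image_def
    by (rule prod.cong) (auto simp: replace_column_def lookup_single)
  then show ?thesis by simp
qed

text \<open>Column \<open>j\<close> is sought as \<open>s \<cdot> a\<close>. The functional \<open>\<phi>\<close> of the
  coefficients is then a polynomial in \<open>s\<close>. Among the monomials of \<open>p\<close> only \<open>x\<^sub>j\<^sup>d\<close> contributes to its
  coefficient at \<open>s\<^sup>d\<close>, which is therefore a nonzero multiple of \<open>\<phi>\<close> evaluated at the \<open>d\<close>-th power of the
  linear form \<open>a\<close>; the vector \<open>a\<close> is chosen to make that nonzero.\<close>

lemma column_avoiding_functional:
  fixes p :: "('n::finite, 'k::field_char_0) poly_ring" and b :: "'j::finite \<Rightarrow> 'n monomial"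
  assumes hom: "homogeneous_of_degree d p"
    and pure: "Poly_Mapping.lookup p (Poly_Mapping.single j d) \<noteq> 0"
    and b: "inj b" "\<And>k. mdeg (b k) = d"
    and \<phi>: "\<phi> k0 \<noteq> 0"
  obtains a where
    "(\<Sum>k\<in>UNIV. \<phi> k * Poly_Mapping.lookup (lin_change (replace_column g j a) p) (b k)) \<noteq> 0"
proof -
  obtain N :: "'n monomial \<Rightarrow> nat" where N: "\<And>u. mdeg u = d \<Longrightarrow> N u > 0"
    "\<And>(a :: 'n \<Rightarrow> 'k) u. mdeg u = d \<Longrightarrow>
      Poly_Mapping.lookup (lin_form a ^ d) u = of_nat (N u) * (\<Prod>i\<in>UNIV. a i ^ Poly_Mapping.lookup u i)"
    using coefficients_of_power_of_linear_form by blast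
  obtain a where a:
    "(\<Sum>k\<in>UNIV. \<phi> k * of_nat (N (b k)) * (\<Prod>i\<in>UNIV. a i ^ Poly_Mapping.lookup (b k) i)) \<noteq> 0"
  proof (rule nonzero_polynomial_function[of UNIV b k0 "\<lambda>k. \<phi> k * of_nat (N (b k))"])
    show "\<phi> k0 * of_nat (N (b k0)) \<noteq> 0" using \<phi> N(1)[OF b(2), of k0] by simp
  qed (use b in auto)
  define C where "C = (\<lambda>v. Poly_Mapping.lookup p v *
    (\<Sum>k\<in>UNIV. \<phi> k * Poly_Mapping.lookup (monomial_image (replace_column g j a) v) (b k)))"
  define q where "q = (\<Sum>v\<in>Poly_Mapping.keys p. monom (C v) (Poly_Mapping.lookup v j))"
  have "coeff q d = (\<Sum>v\<in>Poly_Mapping.keys p. if v = Poly_Mapping.single j d then C v else 0)"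
    unfolding q_def coeff_sum
  proof (intro sum.cong refl)
    fix v assume "v \<in> Poly_Mapping.keys p"
    then have "mdeg v = d" using hom by (simp add: homogeneous_of_degree_def)
    then have "Poly_Mapping.lookup v j = d \<longleftrightarrow> v = Poly_Mapping.single j d"
      using eq_single_if_lookup_eq_mdeg[of v j] by (metis lookup_single_eq)
    then show "coeff (monom (C v) (Poly_Mapping.lookup v j)) d =
        (if v = Poly_Mapping.single j d then C v else 0)"
      by simp
  qed
  also have "\<dots> = C (Poly_Mapping.single j d)"
    using pure by (simp add: in_keys_iff)
  also have "\<dots> \<noteq> 0"
    using pure a unfolding C_def monomial_image_power_of_column
    by (simp add: N(2)[OF b(2)] mult.assoc)
  finally have "q \<noteq> 0" by auto
  then obtain s where s: "poly q s \<noteq> 0" by (rule poly_nonzero_obtains_nonroot)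
  have "(\<Sum>k\<in>UNIV. \<phi> k *
      Poly_Mapping.lookup (lin_change (replace_column g j (\<lambda>i. s * a i)) p) (b k)) =
    (\<Sum>k\<in>UNIV. \<Sum>v\<in>Poly_Mapping.keys p. \<phi> k * (Poly_Mapping.lookup p v *
       (s ^ Poly_Mapping.lookup v j * Poly_Mapping.lookup (monomial_image (replace_column g j a) v) (b k))))"
    unfolding lin_change_eq_sum[OF finite_keys subset_refl] monomial_image_scaled_column
    by (simp add: lookup_sum lookup_const_mult sum_distrib_left)
  also have "\<dots> = poly q s"
    unfolding q_def poly_sum poly_monom C_def
    by (subst sum.swap) (simp add: sum_distrib_left sum_distrib_right mult_ac)
  finally show thesis using s that by metis
qed


section \<open>A nonsingular coefficient matrix\<close>

text \<open>As a function of one row the determinant is a linear functional; the coefficients are cofactors.\<close>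

lemma det_replace_row:
  fixes A :: "'n::finite \<Rightarrow> 'k::comm_ring_1^'n"
  shows "det (\<chi> j. if j = i then r else A j) =
    (\<Sum>k\<in>UNIV. det (\<chi> j. if j = i then axis k 1 else A j) * r $ k)"
proof -
  have "r = (\<Sum>k\<in>UNIV. r $ k *s axis k 1)"
    by (simp add: vec_eq_iff axis_def if_distrib cong: if_cong)
  then have "det (\<chi> j. if j = i then r else A j) =
      det (\<chi> j. if j = i then (\<Sum>k\<in>UNIV. r $ k *s axis k 1) else A j)"
    by (rule arg_cong)
  then show ?thesis
    by (simp add: det_linear_row_sum det_row_mul mult.commute)
qed

text \<open>The function \<open>b\<close> enumerates the monomials at which coefficients are taken; indexing them by the
  variables makes the matrix square.\<close>

definition coefficient_matrix ::
    "('n \<Rightarrow> 'n monomial) \<Rightarrow> ('n \<Rightarrow> ('n::finite, 'k::comm_ring_1) poly_ring) \<Rightarrow> 'k^'n^'n \<Rightarrow> 'k^'n^'n" where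
  "coefficient_matrix b f g = (\<chi> i k. Poly_Mapping.lookup (lin_change g (f i)) (b k))"

lemma lin_change_replace_column_unused:
  assumes "p \<in> polys_in S" "j \<notin> S"
  shows "lin_change (replace_column g j a) p = lin_change g p"
proof -
  have "monomial_image (replace_column g j a) u = monomial_image g u" if "u \<in> Poly_Mapping.keys p" for u
  proof -
    have "Poly_Mapping.lookup u j = 0"
      using that assms unfolding polys_in_def by (auto simp flip: not_in_keys_iff_lookup_eq_zero)
    then have "lin_form (\<lambda>i. replace_column g j a $ i $ k) ^ Poly_Mapping.lookup u k =
        lin_form (\<lambda>i. g $ i $ k) ^ Poly_Mapping.lookup u k" for k
      by (cases "k = j") (simp_all add: replace_column_def)
    then show ?thesis unfolding monomial_image_def by simp
  qed
  then show ?thesis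
    by (simp add: lin_change_eq_sum[OF finite_keys subset_refl])
qed

lemma mat_1_eq_axis_rows: "mat 1 = (\<chi> j. axis j (1 :: 'k::zero_neq_one))"
  by (simp add: vec_eq_iff mat_def axis_def)

text \<open>Rows are switched on from the last to the first: rows outside the upper set \<open>T\<close> are still those of
  the identity matrix. The next row is that of the least element \<open>i\<close> of \<open>T\<close>; changing column \<open>i\<close> of \<open>g\<close>
  leaves the later rows alone, and the functional to be kept nonzero is the determinant as a function of
  row \<open>i\<close>.\<close>

lemma exists_nonsingular_coefficient_matrix:
  fixes f :: "'n::{finite,linorder} \<Rightarrow> ('n, 'k::field_char_0) poly_ring"
  assumes hom: "\<And>i. homogeneous_of_degree d (f i)"
    and tri: "\<And>i. f i \<in> polys_in {i..}"
    and pure: "\<And>i. Poly_Mapping.lookup (f i) (Poly_Mapping.single i d) \<noteq> 0"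
    and b: "inj b" "\<And>k. mdeg (b k) = d"
  obtains g where "det (coefficient_matrix b f g) \<noteq> 0"
proof -
  have "\<exists>g. det (\<chi> j. if j \<in> T then coefficient_matrix b f g $ j else axis j 1) \<noteq> 0"
    if "\<And>i j. i \<in> T \<Longrightarrow> i \<le> j \<Longrightarrow> j \<in> T" for T :: "'n set"
    using finite[of T] that
  proof (induction T rule: finite_psubset_induct)
    case (psubset T)
    show ?case
    proof (cases "T = {}")
      case True
      then show ?thesis by (simp add: mat_1_eq_axis_rows[symmetric])
    next
      case False
      define i where "i = Min T"
      have i: "i \<in> T" "\<And>j. j \<in> T \<Longrightarrow> i \<le> j"
        using False psubset.hyps by (auto simp: i_def)
      have "\<exists>g. det (\<chi> j. if j \<in> T - {i} then coefficient_matrix b f g $ j else axis j 1) \<noteq> 0"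
      proof (rule psubset.IH)
        show "T - {i} \<subset> T" using i(1) by blast
        show "k \<in> T - {i}" if "j \<in> T - {i}" "j \<le> k" for j k
          using that psubset.prems[of j k] i(2)[of j] by auto
      qed
      then obtain g where
        g: "det (\<chi> j. if j \<in> T - {i} then coefficient_matrix b f g $ j else axis j 1) \<noteq> 0"
        by blast
      define A where "A j = (if j \<in> T then coefficient_matrix b f g $ j else axis j 1)" for j
      define \<phi> where "\<phi> k = det (\<chi> j. if j = i then axis k 1 else A j)" for k
      have "(\<chi> j. if j \<in> T - {i} then coefficient_matrix b f g $ j else axis j 1) =
          (\<chi> j. if j = i then axis i 1 else A j)"
        by (auto simp: vec_eq_iff A_def)
      \<comment> \<open>Filling row \<open>i\<close> with its unit vector gives the nonzero determinant from before.\<close>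
      with g have "\<phi> i \<noteq> 0" by (simp add: \<phi>_def)
      then obtain a where a: "(\<Sum>k\<in>UNIV. \<phi> k * 
          Poly_Mapping.lookup (lin_change (replace_column g i a) (f i)) (b k)) \<noteq> 0"
        using column_avoiding_functional[OF hom pure b] by blast
      let ?g = "replace_column g i a"
      have rest: "coefficient_matrix b f ?g $ j = coefficient_matrix b f g $ j" if "j \<in> T" "j \<noteq> i" for j
      proof -
        have "i \<notin> {j..}" using i(2)[OF that(1)] that(2) by auto
        then show ?thesis
          by (simp add: coefficient_matrix_def lin_change_replace_column_unused[OF tri])
      qed
      have "(if j \<in> T then coefficient_matrix b f ?g $ j else axis j 1) =
          (if j = i then coefficient_matrix b f ?g $ i else A j)" for j
        using i(1) rest[of j] by (cases "j = i") (simp_all add: A_def)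
      moreover have "det (\<chi> j. if j = i then coefficient_matrix b f ?g $ i else A j) \<noteq> 0"
        using a by (subst det_replace_row) (simp add: coefficient_matrix_def flip: \<phi>_def)
      ultimately show ?thesis by (intro exI[of _ ?g]) simp
    qed
  qed
  from this[of UNIV] show thesis using that by auto
qed


section \<open>Open sets of coordinate changes\<close>

definition polynomial_fun :: "('k::comm_ring_1 \<Rightarrow> 'k) \<Rightarrow> bool" where
  "polynomial_fun F \<longleftrightarrow> (\<exists>q. \<forall>t. F t = poly q t)"

lemma polynomial_fun_const: "polynomial_fun (\<lambda>_. c)"
  unfolding polynomial_fun_def by (intro exI[of _ "[:c:]"]) simp

lemma polynomial_fun_line: "polynomial_fun (\<lambda>t. a + t * b)"
  unfolding polynomial_fun_def by (intro exI[of _ "[:a, b:]"]) simp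

lemma polynomial_fun_mult:
  "polynomial_fun F \<Longrightarrow> polynomial_fun G \<Longrightarrow> polynomial_fun (\<lambda>t. F t * G t)"
  unfolding polynomial_fun_def by (metis poly_mult)

lemma polynomial_fun_power: "polynomial_fun F \<Longrightarrow> polynomial_fun (\<lambda>t. F t ^ m)"
  unfolding polynomial_fun_def by (metis poly_power)

lemma polynomial_fun_sum:
  assumes "\<And>x. x \<in> A \<Longrightarrow> polynomial_fun (F x)"
  shows "polynomial_fun (\<lambda>t. \<Sum>x\<in>A. F x t)"
proof -
  from assms obtain q where "\<And>x t. x \<in> A \<Longrightarrow> F x t = poly (q x) t"
    unfolding polynomial_fun_def by metis
  then show ?thesis
    unfolding polynomial_fun_def by (intro exI[of _ "\<Sum>x\<in>A. q x"]) (simp add: poly_sum)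
qed

lemma polynomial_fun_prod:
  assumes "\<And>x. x \<in> A \<Longrightarrow> polynomial_fun (F x)"
  shows "polynomial_fun (\<lambda>t. \<Prod>x\<in>A. F x t)"
proof -
  from assms obtain q where "\<And>x t. x \<in> A \<Longrightarrow> F x t = poly (q x) t"
    unfolding polynomial_fun_def by metis
  then show ?thesis
    unfolding polynomial_fun_def by (intro exI[of _ "\<Prod>x\<in>A. q x"]) (simp add: poly_prod)
qed

lemma polynomial_fun_det:
  assumes "\<And>i j. polynomial_fun (\<lambda>t. A t $ i $ j)"
  shows "polynomial_fun (\<lambda>t. det (A t))"
  unfolding det_def
  by (intro polynomial_fun_sum polynomial_fun_mult polynomial_fun_prod polynomial_fun_const assms)

text \<open>A family of polynomials depending polynomially on \<open>t\<close> is one polynomial with coefficients in the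
  polynomial ring, evaluated at the constant \<open>t\<close>; such families are visibly closed under products.\<close>

lemma lookup_poly_at_const:
  "Poly_Mapping.lookup (poly P (const_poly t)) u = poly (map_poly (\<lambda>c. Poly_Mapping.lookup c u) P) t"
  by (induction P) (simp_all add: map_poly_pCons lookup_add lookup_const_mult)

definition matrix_line :: "'k::comm_ring_1^'n^'n \<Rightarrow> 'k^'n^'n \<Rightarrow> 'k \<Rightarrow> 'k^'n^'n" where
  "matrix_line g h t = (\<chi> i j. g $ i $ j + t * (h $ i $ j - g $ i $ j))"

lemma matrix_line_0 [simp]: "matrix_line g h 0 = g"
  by (simp add: matrix_line_def vec_eq_iff)

lemma matrix_line_1 [simp]: "matrix_line g h 1 = h"
  by (simp add: matrix_line_def vec_eq_iff)

lemma polynomial_fun_matrix_line: "polynomial_fun (\<lambda>t. matrix_line g h t $ i $ j)"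
  by (simp add: matrix_line_def polynomial_fun_line)

lemma polynomial_fun_lookup_lin_change:
  "polynomial_fun (\<lambda>t. Poly_Mapping.lookup (lin_change (matrix_line g h t) p) u)"
proof -
  have lf: "lin_form (\<lambda>i. matrix_line g h t $ i $ j) =
      poly [:lin_form (\<lambda>i. g $ i $ j), lin_form (\<lambda>i. h $ i $ j - g $ i $ j):] (const_poly t)" for t j
    by (simp add: matrix_line_def lin_form_add lin_form_scale)
  have img: "\<exists>P. \<forall>t. monomial_image (matrix_line g h t) v = poly P (const_poly t)" for v
    unfolding monomial_image_def lf poly_power[symmetric] poly_prod[symmetric] by blast
  have "polynomial_fun (\<lambda>t. Poly_Mapping.lookup (monomial_image (matrix_line g h t) v) u)" for v
    using img[of v] unfolding polynomial_fun_def by (metis lookup_poly_at_const)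
  then show ?thesis
    unfolding lin_change_eq_sum[OF finite_keys subset_refl] lookup_sum lookup_const_mult
    by (intro polynomial_fun_sum polynomial_fun_mult polynomial_fun_const)
qed

text \<open>Join a point \<open>g\<close> of \<open>U\<close> to the point \<open>h\<close> by a line. On this line \<open>D\<close>, the determinant and the polynomial
  that is nonzero at \<open>g\<close> are nonzero univariate polynomials, so all three are nonzero at a common
  parameter.\<close>

lemma zariski_open_meets_nonvanishing:
  fixes U :: "('k::field_char_0^'n::finite^'n) set"
  assumes "zariski_open_GL U" "U \<noteq> {}"
    and D: "\<And>g h. polynomial_fun (\<lambda>t. D (matrix_line g h t))" and h: "D h \<noteq> 0"
  obtains g where "g \<in> U" "D g \<noteq> 0"
proof -
  obtain P :: "('n \<times> 'n, 'k) poly_ring set" where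
    U: "U = {g. invertible g \<and> (\<exists>p\<in>P. poly_hom (\<lambda>c. c) (\<lambda>(i, j). g $ i $ j) p \<noteq> 0)}"
    using assms(1) unfolding zariski_open_GL_def by blast
  then obtain g p where g: "invertible g" "p \<in> P" "poly_hom (\<lambda>c. c) (\<lambda>(i, j). g $ i $ j) p \<noteq> 0"
    using assms(2) by blast
  define E where "E g = poly_hom (\<lambda>c. c) (\<lambda>(i, j). g $ i $ j) p" for g :: "'k^'n^'n"
  have "polynomial_fun (\<lambda>t. E (matrix_line g h t))"
    unfolding E_def poly_hom_def
    by (intro polynomial_fun_sum polynomial_fun_mult polynomial_fun_prod polynomial_fun_const
        polynomial_fun_power) (auto simp: split_beta polynomial_fun_matrix_line)
  moreover have "polynomial_fun (\<lambda>t. det (matrix_line g h t))"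
    by (intro polynomial_fun_det polynomial_fun_matrix_line)
  moreover note D[of g h]
  ultimately obtain qE qdet qD where
    q: "\<And>t. E (matrix_line g h t) = poly qE t" "\<And>t. det (matrix_line g h t) = poly qdet t"
       "\<And>t. D (matrix_line g h t) = poly qD t"
    unfolding polynomial_fun_def by blast
  have "poly qE 0 \<noteq> 0" "poly qdet 0 \<noteq> 0" "poly qD 1 \<noteq> 0"
    using g h by (auto simp: q[symmetric] E_def invertible_det_nz)
  then have "qE * qdet * qD \<noteq> 0" by auto
  then obtain t where "poly (qE * qdet * qD) t \<noteq> 0" by (rule poly_nonzero_obtains_nonroot)
  then have "E (matrix_line g h t) \<noteq> 0" "det (matrix_line g h t) \<noteq> 0" "D (matrix_line g h t) \<noteq> 0"
    by (simp_all add: q)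
  then show thesis
    using g(2) by (intro that[of "matrix_line g h t"]) (auto simp: U E_def invertible_det_nz)
qed


section \<open>The degree d part of the generic initial ideal\<close>

lemma keys_lin_change_cases:
  assumes "u \<in> Poly_Mapping.keys (lin_change g p)"
  obtains v where "v \<in> Poly_Mapping.keys p" "mdeg v = mdeg u"
proof -
  have "Poly_Mapping.lookup (lin_change g p) u \<noteq> 0" using assms by (simp add: in_keys_iff)
  then obtain v where v: "v \<in> Poly_Mapping.keys p"
      "Poly_Mapping.lookup (const_poly (Poly_Mapping.lookup p v) * monomial_image g v) u \<noteq> 0"
    unfolding lin_change_eq_sum[OF finite_keys subset_refl] lookup_sum
    by (metis (no_types, lifting) sum.neutral)
  then have "u \<in> Poly_Mapping.keys (monomial_image g v)"
    by (auto simp: lookup_const_mult in_keys_iff)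
  then have "mdeg u = mdeg v"
    using homogeneous_monomial_image[of v g] by (simp add: homogeneous_of_degree_def)
  with v show thesis using that by simp
qed

text \<open>The scalars \<open>c\<close> are the same for all \<open>g\<close> and all monomials: they express the degree \<open>d\<close> part of \<open>p\<close>
  through the generators, and a change of coordinates respects degrees.\<close>

lemma lin_change_degree_part:
  fixes f :: "'n::finite \<Rightarrow> ('n, 'k::comm_ring_1) poly_ring"
  assumes hom: "\<And>i. homogeneous_of_degree d (f i)" and p: "p \<in> ideal_gen (range f)"
  shows "\<exists>c. \<forall>g u. mdeg u = d \<longrightarrow> Poly_Mapping.lookup (lin_change g p) u =
    (\<Sum>i\<in>UNIV. c i * Poly_Mapping.lookup (lin_change g (f i)) u)"
proof -
  have "\<exists>c. \<forall>u. mdeg u = d \<longrightarrow> Poly_Mapping.lookup p u = (\<Sum>i\<in>UNIV. c i * Poly_Mapping.lookup (f i) u)"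
    using p
  proof (induction p rule: ring_module.span_induct_alt)
    case base
    show ?case by (intro exI[of _ "\<lambda>_. 0"]) simp
  next
    case (step a x y)
    then obtain i c where i: "x = f i"
      and c: "\<And>u. mdeg u = d \<Longrightarrow> Poly_Mapping.lookup y u = (\<Sum>i\<in>UNIV. c i * Poly_Mapping.lookup (f i) u)"
      by blast
    show ?case
    proof (intro exI[of _ "\<lambda>j. (if j = i then Poly_Mapping.lookup a 0 else 0) + c j"] allI impI)
      fix u :: "'n monomial" assume u: "mdeg u = d"
      show "Poly_Mapping.lookup (a * x + y) u =
        (\<Sum>j\<in>UNIV. ((if j = i then Poly_Mapping.lookup a 0 else 0) + c j) * Poly_Mapping.lookup (f j) u)"
        using u by (simp add: lookup_add i c lookup_mult_homogeneous[OF hom] distrib_right sum.distrib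
            if_distrib[of "\<lambda>x. x * _"] cong: if_cong)
    qed
  qed
  then obtain c where c: "\<And>u. mdeg u = d \<Longrightarrow> Poly_Mapping.lookup p u = (\<Sum>i\<in>UNIV. c i * Poly_Mapping.lookup (f i) u)"
    by blast
  define r where "r = p - (\<Sum>i\<in>UNIV. const_poly (c i) * f i)"
  have r: "Poly_Mapping.lookup r u = 0" if "mdeg u = d" for u
    using c[OF that] by (simp add: r_def lookup_minus lookup_sum lookup_const_mult)
  have "Poly_Mapping.lookup (lin_change g r) u = 0" if "mdeg u = d" for g u
    using keys_lin_change_cases[of u g r] r that by (metis in_keys_iff)
  moreover have "lin_change g p = lin_change g r + (\<Sum>i\<in>UNIV. const_poly (c i) * lin_change g (f i))" for g
    by (simp add: r_def lin_change_const_mult[symmetric] lin_change_sum[symmetric] lin_change_add[symmetric])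
  ultimately have "Poly_Mapping.lookup (lin_change g p) u = (\<Sum>i\<in>UNIV. c i * Poly_Mapping.lookup (lin_change g (f i)) u)"
    if "mdeg u = d" for g u
    using that by (simp add: lookup_add lookup_sum lookup_const_mult)
  then show ?thesis by blast
qed

text \<open>For one inclusion, an initial monomial \<open>v\<close> that divides a monomial of degree \<open>d\<close> must itself have
  degree \<open>d\<close>; the combination of generators behind it has a nonzero coefficient somewhere on \<open>M\<close> because
  the matrix is nonsingular, so \<open>v\<close> is at or above an element of the upper segment \<open>M\<close>. For the other,
  inverting the matrix gives a combination whose only monomial in \<open>M\<close> is a prescribed \<open>u\<close>; all its other
  monomials lie outside \<open>M\<close>, hence below \<open>u\<close>.\<close>

lemma monomials_of_initial_ideal:
  fixes f :: "'n::{finite,linorder} \<Rightarrow> ('n, 'k::field) poly_ring"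
  assumes hom: "\<And>i. homogeneous_of_degree d (f i)"
    and M: "range b = M"
    and Md: "\<And>u. u \<in> M \<Longrightarrow> mdeg u = d"
    and up: "\<And>u v. u \<in> M \<Longrightarrow> mdeg v = d \<Longrightarrow> revlex_less u v \<Longrightarrow> v \<in> M"
    and det: "det (coefficient_matrix b f g) \<noteq> 0"
  shows "monomials_of_degree (initial_ideal (lin_change g ` ideal_gen (range f))) d = M"
proof -
  let ?I = "lin_change g ` ideal_gen (range f)"
  let ?V = "{u. \<exists>p\<in>?I. is_initial_monomial u p}"
  have ini: "initial_ideal ?I = ideal_gen (mono_poly ` ?V)"
    unfolding initial_ideal_def by (rule arg_cong[of _ _ ideal_gen]) auto
  have "invertible (coefficient_matrix b f g)" using det by (simp add: invertible_det_nz)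
  then obtain B where B: "coefficient_matrix b f g ** B = mat 1" "B ** coefficient_matrix b f g = mat 1"
    unfolding invertible_def by blast
  show ?thesis
  proof (intro equalityI subsetI)
    fix u assume "u \<in> monomials_of_degree (initial_ideal ?I) d"
    then have u: "mdeg u = d" "mono_poly u \<in> ideal_gen (mono_poly ` ?V :: ('n, 'k) poly_ring set)"
      by (auto simp: monomials_of_degree_def ini)
    then obtain v w where v: "v \<in> ?V" "u = w + v" using mono_poly_in_monomial_ideal by blast
    then obtain p where p: "p \<in> ideal_gen (range f)" "is_initial_monomial v (lin_change g p)" by blast
    then have vk: "v \<in> Poly_Mapping.keys (lin_change g p)" by (simp add: is_initial_monomial_def)
    then have "d \<le> mdeg v" using mdeg_ge_in_ideal[OF hom p(1)] by (metis keys_lin_change_cases)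
    moreover have "mdeg w + mdeg v = d" using u(1) unfolding v(2) mdeg_add .
    ultimately have "mdeg w = 0" and vd: "mdeg v = d" by simp_all
    then have uv: "u = v" unfolding v(2) mdeg_eq_0_iff by simp
    obtain c where c: "\<forall>h u. mdeg u = d \<longrightarrow> Poly_Mapping.lookup (lin_change h p) u =
        (\<Sum>i\<in>UNIV. c i * Poly_Mapping.lookup (lin_change h (f i)) u)"
      using lin_change_degree_part[OF hom p(1)] ..
    have "\<exists>k. Poly_Mapping.lookup (lin_change g p) (b k) \<noteq> 0"
    proof (rule ccontr)
      assume "\<not> ?thesis"
      then have "(\<chi> i. c i) v* coefficient_matrix b f g = 0"
        using c Md M by (auto simp: vec_eq_iff vector_matrix_mult_def coefficient_matrix_def mult.commute)
      then have "(\<chi> i. c i) v* (coefficient_matrix b f g ** B) = 0"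
        by (metis vector_matrix_mul_assoc vector_matrix_mult_0)
      then have "(\<chi> i. c i) = 0"
        by (simp add: B)
      then have "c i = 0" for i by (simp add: vec_eq_iff)
      then show False using c vd vk by (simp add: in_keys_iff)
    qed
    then obtain k where k: "b k \<in> Poly_Mapping.keys (lin_change g p)" by (auto simp: in_keys_iff)
    have "b k \<in> M" using M by blast
    moreover have "b k = v \<or> revlex_less (b k) v"
      using p(2) k by (auto simp: is_initial_monomial_def)
    ultimately show "u \<in> M" using up[of "b k" v] vd uv by auto
  next
    fix u assume u: "u \<in> M"
    then obtain k where k: "u = b k" using M by blast
    define c where "c = axis k 1 v* B"
    have c: "c v* coefficient_matrix b f g = axis k 1"
      by (simp add: c_def vector_matrix_mul_assoc B)
    define p where "p = (\<Sum>i\<in>UNIV. const_poly (c $ i) * f i)"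
    have "p \<in> ideal_gen (range f)"
      unfolding p_def by (intro ring_module.span_sum ring_module.span_scale ring_module.span_base) auto
    have coef: "Poly_Mapping.lookup (lin_change g p) (b l) = axis k 1 $ l" for l
    proof -
      have "Poly_Mapping.lookup (lin_change g p) (b l) =
          (\<Sum>i\<in>UNIV. c $ i * Poly_Mapping.lookup (lin_change g (f i)) (b l))"
        unfolding p_def lin_change_sum lin_change_const_mult lookup_sum lookup_const_mult ..
      also have "\<dots> = (c v* coefficient_matrix b f g) $ l"
        by (simp add: vector_matrix_mult_def coefficient_matrix_def mult.commute)
      finally show ?thesis by (simp add: c)
    qed
    have "homogeneous_of_degree d p"
      unfolding p_def by (intro homogeneous_sum homogeneous_const_mult hom)
    then have homp: "homogeneous_of_degree d (lin_change g p)" by (rule homogeneous_lin_change)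
    have "is_initial_monomial u (lin_change g p)"
      unfolding is_initial_monomial_def
    proof (intro conjI ballI impI)
      show "u \<in> Poly_Mapping.keys (lin_change g p)"
        using coef[of k] by (simp add: in_keys_iff k axis_def)
      fix v assume v: "v \<in> Poly_Mapping.keys (lin_change g p)" "v \<noteq> u"
      have "mdeg v = d" using v homp by (simp add: homogeneous_of_degree_def)
      have "v \<notin> M"
      proof
        assume "v \<in> M"
        then obtain l where "v = b l" using M by blast
        then show False using v coef[of l] k by (auto simp: in_keys_iff axis_def split: if_splits)
      qed
      then have "\<not> revlex_less u v" using up[OF u \<open>mdeg v = d\<close>] by blast
      then show "revlex_less v u"
        using revlex_less_total[of v u] v(2) \<open>mdeg v = d\<close> Md[OF u] by auto
    qed
    then have "mono_poly u \<in> initial_ideal ?I"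
      unfolding ini using \<open>p \<in> ideal_gen (range f)\<close> by (intro ring_module.span_base) blast
    then show "u \<in> monomials_of_degree (initial_ideal ?I) d"
      using Md[OF u] by (simp add: monomials_of_degree_def)
  qed
qed

text \<open>Regularity enters only through the coefficients of \<open>x\<^sub>i\<^sup>d\<close>. Stated in terms of these, the result
  also covers the generators \<open>x\<^sub>1\<^sup>d, \<dots>, x\<^sub>n\<^sup>d\<close> of a monomial complete intersection directly, which may have
  been given in another order.\<close>

theorem revlex_set_Gin_if_pure_powers_occur:
  fixes f :: "'n::{finite,linorder} \<Rightarrow> ('n, 'k::field_char_0) poly_ring"
  assumes "d > 0"
    and hom: "\<And>i. homogeneous_of_degree d (f i)"
    and tri: "\<And>i. f i \<in> polys_in {i..}"
    and pure: "\<And>i. Poly_Mapping.lookup (f i) (Poly_Mapping.single i d) \<noteq> 0"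
    and Gin: "is_Gin (ideal_gen (range f)) J"
  shows "revlex_set (monomials_of_degree J d)"
proof -
  obtain M :: "'n monomial set" where
    M: "\<And>u. u \<in> M \<Longrightarrow> mdeg u = d" "card M = CARD('n)" "finite M"
    "\<And>u v. u \<in> M \<Longrightarrow> mdeg v = d \<Longrightarrow> revlex_less u v \<Longrightarrow> v \<in> M"
    using revlex_top_segment[OF card_variables_le_card_monomials[OF \<open>d > 0\<close>]] by blast
  obtain b :: "'n \<Rightarrow> 'n monomial" where "bij_betw b UNIV M"
    using M(2,3) by (metis finite_same_card_bij finite)
  then have b: "inj b" "range b = M" by (auto simp: bij_betw_def)
  have bd: "mdeg (b k) = d" for k using M(1) b(2) by blast
  obtain U where U: "zariski_open_GL U" "U \<noteq> {}"
    "\<And>g. g \<in> U \<Longrightarrow> initial_ideal (lin_change g ` ideal_gen (range f)) = J"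
    using Gin unfolding is_Gin_def by blast
  obtain h where h: "det (coefficient_matrix b f h) \<noteq> 0"
    using exists_nonsingular_coefficient_matrix[OF hom tri pure b(1) bd] by blast
  have line: "polynomial_fun (\<lambda>t. det (coefficient_matrix b f (matrix_line g h t)))" for g h
    by (rule polynomial_fun_det) (simp add: coefficient_matrix_def polynomial_fun_lookup_lin_change)
  obtain g where g: "g \<in> U" "det (coefficient_matrix b f g) \<noteq> 0"
    using zariski_open_meets_nonvanishing[OF U(1,2) line h] by blast
  have "monomials_of_degree J d = M"
    using monomials_of_initial_ideal[OF hom b(2) M(1,4) g(2)] U(3)[OF g(1)] by simp
  moreover have "revlex_set M"
    unfolding revlex_set_def using M(1) M(4) by metis
  ultimately show ?thesis by simp
qed

theorem theorem1p5:
  fixes d :: nat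
  assumes "CARD('n) \<ge> 2" and "d \<ge> 2"
  shows
    "(\<forall>(f :: 'n::{finite,linorder} \<Rightarrow> ('n, 'k::{alg_closed_field,field_char_0}) poly_ring) J.
        (\<forall>i. homogeneous_of_degree d (f i)) \<longrightarrow>
        regular_seq f \<longrightarrow>
        (\<forall>i. f i \<in> polys_in {i..}) \<longrightarrow>
        is_Gin (ideal_gen (range f)) J \<longrightarrow>
        revlex_set (monomials_of_degree J d)) \<and>
     (\<forall>(I :: ('n, 'k) poly_ring set) J.
        monomial_complete_intersection d I \<longrightarrow>
        is_Gin I J \<longrightarrow>
        revlex_set (monomials_of_degree J d))"
proof (rule conjI; intro allI impI)
  fix f :: "'n \<Rightarrow> ('n, 'k) poly_ring" and J
  assume "\<forall>i. homogeneous_of_degree d (f i)" and reg: "regular_seq f"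
    and "\<forall>i. f i \<in> polys_in {i..}" and Gin: "is_Gin (ideal_gen (range f)) J"
  then have hom: "\<And>i. homogeneous_of_degree d (f i)" and tri: "\<And>i. f i \<in> polys_in {i..}"
    by blast+
  show "revlex_set (monomials_of_degree J d)"
    using assms(2) Gin
    by (intro revlex_set_Gin_if_pure_powers_occur[OF _ hom tri
          regular_triangular_pure_power[OF hom reg tri]]) simp_all
next
  fix I J :: "('n, 'k) poly_ring set"
  assume I: "monomial_complete_intersection d I" and J: "is_Gin I J"
  have d: "d > 0" using assms(2) by simp
  let ?f = "\<lambda>i. mono_poly (Poly_Mapping.single i d) :: ('n, 'k) poly_ring"
  show "revlex_set (monomials_of_degree J d)"
  proof (rule revlex_set_Gin_if_pure_powers_occur[OF d])
    show "homogeneous_of_degree d (?f i)" for i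
      by (simp add: homogeneous_of_degree_def mono_poly_def)
    show "?f i \<in> polys_in {i..}" for i
      using d by (simp add: polys_in_def mono_poly_def)
    show "Poly_Mapping.lookup (?f i) (Poly_Mapping.single i d) \<noteq> 0" for i
      by (simp add: mono_poly_def)
    show "is_Gin (ideal_gen (range ?f)) J"
      using J monomial_complete_intersection_eq[OF I d] by simp
  qed
qed

end
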